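(* For all graphs $G$ and $H$, $$\operatorname{tw}(G\boxtimes H)\geq (\operatorname{tw}(G)+1)(\operatorname{tw}(H)+1)-1.$$
   Context: All graphs are simple, finite and undirected. A tree-decomposition of a graph $G$ is a pair $(T,\beta)$ consisting of a tree $T$ and a function $\beta:V(T)\to 2^{V(G)}$ such that (i) for every $v\in V(G)$, the set $\{t\in V(T): v\in\beta(t)\}$ is non-empty and induces a connected subgraph of $T$; and (ii) for every edge $uv\in E(G)$ there is $t\in V(T)$ with $\{u,v\}\subseteq\beta(t)$. Its width is $\max_{t\in V(T)}|\beta(t)|-1$. The treewidth $\operatorname{tw}(G)$ is the minimum width of a tree-decomposition of $G$. The strong product $G\boxtimes H$ is the graph with vertex set $V(G)\times V(H)$, where $(g_1,h_1)(g_2,h_2)$ is an edge if and only if $g_1=g_2$ and $h_1h_2\in E(H)$; or $g_1g_2\in E(G)$ and $h_1=h_2$; or $g_1g_2\in E(G)$ and $h_1h_2\in E(H)$. *)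

theory Defs
  imports "Graph_Theory.Graph_Theory"
begin

text \<open>
  A finite simple undirected graph is a \<^locale>\<open>pair_graph\<close>: a finite, loopfree digraph whose
  arc set is symmetric, so that an edge \<open>uv\<close> is the pair of arcs \<open>(u, v)\<close> and \<open>(v, u)\<close>.
  The null graph is allowed.

  The library's \<^const>\<open>tree\<close> cannot be used for such a graph: its \<^const>\<open>forest\<close> also forbids
  the directed 2-cycle \<open>u, v, u\<close> that every undirected edge gives rise to. A cycle of an
  undirected graph is a directed cycle of length at least 3. As \<^const>\<open>connected\<close> includes
  non-emptiness, a tree has at least one node.
\<close>

definition undirected_tree :: "'t pair_pre_digraph \<Rightarrow> bool" where
  "undirected_tree T \<longleftrightarrow>
     pair_graph T \<and> Digraph_Component.connected (with_proj T) \<and>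
     \<not> (\<exists>p. pre_digraph.cycle (with_proj T) p \<and> 3 \<le> length p)"

definition tree_decomposition ::
    "'a pair_pre_digraph \<Rightarrow> 't pair_pre_digraph \<Rightarrow> ('t \<Rightarrow> 'a set) \<Rightarrow> bool" where
  "tree_decomposition G T \<beta> \<longleftrightarrow>
     undirected_tree T \<and>
     (\<forall>t\<in>pverts T. \<beta> t \<subseteq> pverts G) \<and>
     (\<forall>v\<in>pverts G. {t \<in> pverts T. v \<in> \<beta> t} \<noteq> {} \<and>
        Digraph_Component.connected (with_proj T \<restriction> {t \<in> pverts T. v \<in> \<beta> t})) \<and>
     (\<forall>(u, v)\<in>parcs G. \<exists>t\<in>pverts T. {u, v} \<subseteq> \<beta> t)"

text \<open>
  Widths are integers: the null graph has a tree-decomposition of width \<open>-1\<close>.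
\<close>

definition decomposition_width :: "'t pair_pre_digraph \<Rightarrow> ('t \<Rightarrow> 'a set) \<Rightarrow> int" where
  "decomposition_width T \<beta> = int (Max ((\<lambda>t. card (\<beta> t)) ` pverts T)) - 1"

text \<open>
  A definition cannot quantify over the type of the nodes of \<open>T\<close>. Since \<open>T\<close> is finite, letting
  its nodes be natural numbers is no restriction.
\<close>

definition treewidth :: "'a pair_pre_digraph \<Rightarrow> int" where
  "treewidth G =
     (LEAST w. \<exists>(T :: nat pair_pre_digraph) \<beta>.
        tree_decomposition G T \<beta> \<and> w = decomposition_width T \<beta>)"

definition strong_product ::
    "'a pair_pre_digraph \<Rightarrow> 'b pair_pre_digraph \<Rightarrow> ('a \<times> 'b) pair_pre_digraph"
    (infixl \<open>\<boxtimes>\<close> 70) where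
  "G \<boxtimes> H =
     \<lparr> pverts = pverts G \<times> pverts H,
       parcs = {((g1, h1), (g2, h2)) | g1 h1 g2 h2.
         g1 \<in> pverts G \<and> g1 = g2 \<and> (h1, h2) \<in> parcs H \<or>
         (g1, g2) \<in> parcs G \<and> h1 \<in> pverts H \<and> h1 = h2 \<or>
         (g1, g2) \<in> parcs G \<and> (h1, h2) \<in> parcs H} \<rparr>"

lemma pair_graph_strong_product:
  assumes "pair_graph G" and "pair_graph H"
  shows "pair_graph (G \<boxtimes> H)"
proof -
  interpret G: pair_graph G by fact
  interpret H: pair_graph H by fact
  have sub: "parcs (G \<boxtimes> H) \<subseteq> (pverts G \<times> pverts H) \<times> (pverts G \<times> pverts H)"
    by (auto simp: strong_product_def dest: G.wellformed' H.wellformed')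
  show ?thesis
  proof
    fix e assume e: "e \<in> parcs (G \<boxtimes> H)"
    show "fst e \<in> pverts (G \<boxtimes> H)" "snd e \<in> pverts (G \<boxtimes> H)"
      using e subsetD[OF sub e] by (cases e; simp add: strong_product_def mem_Times_iff)+
    show "fst e \<noteq> snd e"
      using e by (auto simp: strong_product_def dest: G.no_loops' H.no_loops')
  next
    show "finite (pverts (G \<boxtimes> H))" by (simp add: strong_product_def)
    show "finite (parcs (G \<boxtimes> H))" by (rule finite_subset[OF sub]) simp
    show "symmetric (with_proj (G \<boxtimes> H))"
      by (auto simp: symmetric_def strong_product_def intro!: symI
          dest: G.arcs_symmetric H.arcs_symmetric)
  qed
qed

text \<open>The minimum in the definition of \<^const>\<open>treewidth\<close> is attained.\<close>

lemma tree_decomposition_single_bag: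
  assumes "pair_graph G"
  shows "tree_decomposition G \<lparr> pverts = {0 :: nat}, parcs = {} \<rparr> (\<lambda>_. pverts G)"
proof -
  interpret G: pair_graph G by fact
  let ?T = "\<lparr> pverts = {0 :: nat}, parcs = {} \<rparr>"
  interpret T: pair_graph ?T
    by unfold_locales (auto simp: symmetric_def)
  have conn: "Digraph_Component.connected K" if "verts K = {0 :: nat}" for K :: "(nat, nat \<times> nat) pre_digraph"
    using that
    by (auto simp: Digraph_Component.connected_def strongly_connected_def mk_symmetric_def
        reachable_def)
  have "\<not> (\<exists>p. pre_digraph.cycle (with_proj ?T) p \<and> 3 \<le> length p)"
    by (auto simp: T.cycle_def T.awalk_def)
  then have "undirected_tree ?T"
    unfolding undirected_tree_def using T.pair_graph by (auto intro!: conn)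
  then show ?thesis
    unfolding tree_decomposition_def
    by (auto intro!: conn dest: G.wellformed')
qed

lemma decomposition_width_ge: "decomposition_width T \<beta> \<ge> -1"
  by (simp add: decomposition_width_def)

lemma
  assumes "pair_graph G"
  shows treewidth_attained: "\<exists>(T :: nat pair_pre_digraph) \<beta>.
      tree_decomposition G T \<beta> \<and> decomposition_width T \<beta> = treewidth G"
    and treewidth_le: "\<And>(T :: nat pair_pre_digraph) \<beta>.
      tree_decomposition G T \<beta> \<Longrightarrow> treewidth G \<le> decomposition_width T \<beta>"
proof -
  define P where "P w \<longleftrightarrow> (\<exists>(T :: nat pair_pre_digraph) \<beta>.
      tree_decomposition G T \<beta> \<and> w = decomposition_width T \<beta>)" for w
  define k where "k = (LEAST k. P (int k - 1))"
  have nat_form: "w = int (nat (w + 1)) - 1" if "P w" for w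
  proof -
    have "w \<ge> -1" using that decomposition_width_ge unfolding P_def by blast
    then show ?thesis by simp
  qed
  obtain w0 where "P w0"
    using tree_decomposition_single_bag[OF assms] unfolding P_def by blast
  then have "P (int (nat (w0 + 1)) - 1)"
    using nat_form by metis
  then have Pk: "P (int k - 1)"
    unfolding k_def by (rule LeastI)
  have le: "int k - 1 \<le> w" if "P w" for w
  proof -
    have "P (int (nat (w + 1)) - 1)" using that nat_form by metis
    then have "k \<le> nat (w + 1)" unfolding k_def by (rule Least_le)
    then show ?thesis using nat_form[OF that] by linarith
  qed
  have tw: "treewidth G = int k - 1"
    unfolding treewidth_def P_def[symmetric] using Pk le by (rule Least_equality)
  show "\<exists>(T :: nat pair_pre_digraph) \<beta>.
      tree_decomposition G T \<beta> \<and> decomposition_width T \<beta> = treewidth G"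
    using Pk unfolding tw P_def by metis
  show "treewidth G \<le> decomposition_width T \<beta>"
    if "tree_decomposition G T \<beta>" for T :: "nat pair_pre_digraph" and \<beta>
    unfolding tw using that by (intro le) (auto simp: P_def)
qed

end

theory Submission
  imports Defs
begin

text \<open>
  If \<open>tw(H) + 1 = n\<close>, tree-width duality provides a bramble \<open>\<B>\<close> of \<open>H\<close> that no set of fewer than
  \<open>n\<close> vertices covers. Given a tree-decomposition \<open>(T, \<beta>)\<close> of \<open>G \<boxtimes> H\<close> and \<open>g \<in> V(G)\<close>, the nodes whose
  bag meets \<open>{g} \<times> A\<close> form a subtree \<open>S g A\<close> of \<open>T\<close> for each \<open>A \<in> \<B>\<close>. For equal or adjacent \<open>g, g'\<close>
  all the subtrees \<open>S g A\<close> and \<open>S g' B\<close> meet pairwise, so by the Helly property the bags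
  \<open>\<gamma> t = {g. \<forall>A\<in>\<B>. t \<in> S g A}\<close> form a tree-decomposition of \<open>G\<close>. Each \<open>g \<in> \<gamma> t\<close> contributes a cover
  of \<open>\<B>\<close> to \<open>\<beta> t\<close>, so that \<open>|\<beta> t| \<ge> n |\<gamma> t|\<close>, and some \<open>\<gamma> t\<close> has at least \<open>tw(G) + 1\<close> elements.

  The duality proof follows Bellenbaum and Diestel. Where they take disjoint paths from Menger's
  theorem, here an exchange argument constructs a new cover of the bramble and compares it with a
  minimum one.
\<close>

section \<open>Connected sets and trees\<close>

text \<open>Connectedness of the subgraph induced on \<open>A\<close>, used for symmetric
  \<open>E\<close>. Non-emptiness is built in, so that applying it to
  \<open>{t \<in> N. v \<in> \<beta> t}\<close> expresses the whole first axiom of a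
  tree-decomposition.\<close>

definition conn :: "'a rel \<Rightarrow> 'a set \<Rightarrow> bool" where
  "conn E A \<longleftrightarrow> A \<noteq> {} \<and> (\<forall>x\<in>A. \<forall>y\<in>A. (x, y) \<in> (Restr E A)\<^sup>*)"

definition touch :: "'a rel \<Rightarrow> 'a set \<Rightarrow> 'a set \<Rightarrow> bool" where
  "touch E A B \<longleftrightarrow> A \<inter> B \<noteq> {} \<or> E \<inter> A \<times> B \<noteq> {}"

lemma touch_sym: "sym E \<Longrightarrow> touch E A B \<Longrightarrow> touch E B A"
  unfolding touch_def sym_def by blast

lemma conn_nonempty: "conn E A \<Longrightarrow> A \<noteq> {}"
  by (simp add: conn_def)

lemma conn_singleton: "conn E {x}"
  by (simp add: conn_def)

lemma conn_mono: "conn E A \<Longrightarrow> E \<subseteq> E' \<Longrightarrow> conn E' A"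
  unfolding conn_def by (meson Int_mono order_refl rtrancl_mono subsetD)

lemma conn_induct [consumes 3, case_names base step]:
  assumes "conn E A" "x \<in> A" "y \<in> A"
    and base: "P x"
    and step: "\<And>u v. u \<in> A \<Longrightarrow> v \<in> A \<Longrightarrow> (u, v) \<in> E \<Longrightarrow> P u \<Longrightarrow> P v"
  shows "P y"
proof -
  have "(x, y) \<in> (Restr E A)\<^sup>*"
    using assms(1-3) by (auto simp: conn_def)
  then show ?thesis
    by (induction rule: rtrancl_induct) (auto intro: base step)
qed

lemma connI_center:
  assumes "sym E" "c \<in> A" "\<And>y. y \<in> A \<Longrightarrow> (c, y) \<in> (Restr E A)\<^sup>*"
  shows "conn E A"
proof -
  have "sym ((Restr E A)\<^sup>*)"
    using assms(1) by (intro sym_rtrancl) (auto simp: sym_def)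
  then show ?thesis
    unfolding conn_def using assms(2,3) by (auto dest: symD intro: rtrancl_trans)
qed

lemma conn_image:
  assumes "conn E A" "\<And>x y. x \<in> A \<Longrightarrow> y \<in> A \<Longrightarrow> (x, y) \<in> E \<Longrightarrow> (f x, f y) \<in> E'"
  shows "conn E' (f ` A)"
proof -
  have "(f x, f y) \<in> (Restr E' (f ` A))\<^sup>*" if "x \<in> A" "y \<in> A" for x y
    using assms(1) that
  proof (induction rule: conn_induct)
    case (step u v)
    then have "(f u, f v) \<in> Restr E' (f ` A)" using assms(2) by auto
    with step.IH show ?case by (rule rtrancl_into_rtrancl)
  qed simp
  then show ?thesis using assms(1) by (auto simp: conn_def)
qed

lemma conn_Un:
  assumes "sym E" "conn E A" "conn E B" "touch E A B"
  shows "conn E (A \<union> B)"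
proof -
  let ?R = "(Restr E (A \<union> B))\<^sup>*"
  have mono: "(Restr E A)\<^sup>* \<subseteq> ?R" "(Restr E B)\<^sup>* \<subseteq> ?R"
    by (auto intro!: rtrancl_mono)
  obtain a b where ab: "a \<in> A" "b \<in> B" "(a, b) \<in> ?R"
    using assms(4) unfolding touch_def by blast
  show ?thesis
  proof (rule connI_center[OF assms(1)])
    show "a \<in> A \<union> B" using ab by simp
    fix y assume "y \<in> A \<union> B"
    then consider "y \<in> A" | "y \<in> B" by blast
    then show "(a, y) \<in> ?R"
    proof cases
      case 1 then show ?thesis using assms(2) ab mono by (auto simp: conn_def)
    next
      case 2
      then have "(b, y) \<in> ?R" using assms(3) ab mono by (auto simp: conn_def)
      with ab(3) show ?thesis by (rule rtrancl_trans)
    qed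
  qed
qed

section \<open>Trees as iterated joins, and their subtrees\<close>

text \<open>Induction along this construction replaces arguments about paths: a subtree falls into
  its traces on the two sides, linked only by the edge \<open>ab\<close>. Both orientations of an
  edge are present, as in \<open>parcs\<close>; \<open>undirected_tree_iff\<close> shows that
  exactly the trees of the definition arise.\<close>

inductive tree_on :: "'t set \<Rightarrow> 't rel \<Rightarrow> bool" where
  single: "tree_on {v} {}"
| join: "tree_on N1 F1 \<Longrightarrow> tree_on N2 F2 \<Longrightarrow> N1 \<inter> N2 = {} \<Longrightarrow> a \<in> N1 \<Longrightarrow> b \<in> N2 \<Longrightarrow>
    tree_on (N1 \<union> N2) (F1 \<union> F2 \<union> {(a, b), (b, a)})"

lemma tree_on_basic:
  assumes "tree_on N F"
  shows tree_on_finite: "finite N" and tree_on_edges: "F \<subseteq> N \<times> N" and tree_on_sym: "sym F"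
    and tree_on_irrefl: "irrefl F" and tree_on_conn: "conn F N"
proof -
  have "finite N \<and> F \<subseteq> N \<times> N \<and> sym F \<and> irrefl F \<and> conn F N"
    using assms
  proof induction
    case (join N1 F1 N2 F2 a b)
    let ?F = "F1 \<union> F2 \<union> {(a, b), (b, a)}"
    have "sym ?F" using join.IH by (auto simp: sym_def)
    moreover have "irrefl ?F" using join by (auto simp: irrefl_def)
    moreover have "conn ?F (N1 \<union> N2)"
    proof (rule conn_Un)
      show "conn ?F N1" "conn ?F N2" using join.IH by (auto intro: conn_mono)
      show "touch ?F N1 N2" using join.hyps by (auto simp: touch_def)
    qed fact
    moreover have "?F \<subseteq> (N1 \<union> N2) \<times> (N1 \<union> N2)"
      using join.IH join.hyps by blast
    ultimately show ?case using join.IH by blast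
  qed (auto simp: conn_singleton sym_def irrefl_def)
  then show "finite N" "F \<subseteq> N \<times> N" "sym F" "irrefl F" "conn F N" by auto
qed

lemma tree_on_nonempty: "tree_on N F \<Longrightarrow> N \<noteq> {}"
  by (auto dest: tree_on_conn conn_nonempty)

text \<open>A walk in \<open>A\<close> can leave \<open>N1\<close> only from \<open>a\<close> and
  return only to \<open>a\<close>, so its excursions into \<open>N2\<close> can be cut out. The
  invariant therefore keeps \<open>a\<close> reachable inside \<open>N1\<close> while the walk is in
  \<open>N2\<close>.\<close>

lemma conn_join_left:
  assumes "F1 \<subseteq> N1 \<times> N1" "F2 \<subseteq> N2 \<times> N2" "N1 \<inter> N2 = {}" "a \<in> N1" "b \<in> N2"
    and A: "conn (F1 \<union> F2 \<union> {(a, b), (b, a)}) A" "A \<subseteq> N1 \<union> N2" and ne: "A \<inter> N1 \<noteq> {}"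
  shows "conn F1 (A \<inter> N1) \<and> (A \<inter> N2 \<noteq> {} \<longrightarrow> a \<in> A)"
proof -
  have *: "(z \<in> N1 \<longrightarrow> (x, z) \<in> (Restr F1 (A \<inter> N1))\<^sup>*) \<and>
      (z \<in> N2 \<longrightarrow> a \<in> A \<and> (x, a) \<in> (Restr F1 (A \<inter> N1))\<^sup>*)"
    if x: "x \<in> A \<inter> N1" and z: "z \<in> A" for x z
    using A(1) IntD1[OF x] z
  proof (induction rule: conn_induct)
    case base
    then show ?case using x assms(3) by auto
  next
    case (step u v)
    consider "(u, v) \<in> F1" | "(u, v) \<in> F2" | "u = a" "v = b" | "u = b" "v = a"
      using step.hyps by auto
    then show ?case
    proof cases
      case 1
      then have "(u, v) \<in> Restr F1 (A \<inter> N1)" "v \<notin> N2" using step.hyps assms(1,3) by auto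
      then show ?thesis using step.IH by (auto intro: rtrancl_into_rtrancl)
    next
      case 2
      then show ?thesis using step.IH assms(2,3) by auto
    qed (use step assms(3-5) in auto)
  qed
  show ?thesis
    using * ne unfolding conn_def by blast
qed

lemma join_commute: "F1 \<union> F2 \<union> {(a, b), (b, a)} = F2 \<union> F1 \<union> {(b, a), (a, b)}"
  by blast

lemma conn_join_right:
  assumes "F1 \<subseteq> N1 \<times> N1" "F2 \<subseteq> N2 \<times> N2" "N1 \<inter> N2 = {}" "a \<in> N1" "b \<in> N2"
    and "conn (F1 \<union> F2 \<union> {(a, b), (b, a)}) A" "A \<subseteq> N1 \<union> N2" "A \<inter> N2 \<noteq> {}"
  shows "conn F2 (A \<inter> N2) \<and> (A \<inter> N1 \<noteq> {} \<longrightarrow> b \<in> A)"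
  using conn_join_left[OF assms(2,1) _ assms(5,4), of A] assms(3,6-8)
  by (metis Int_commute Un_commute join_commute)

text \<open>If \<open>A \<inter> B\<close> meets both sides of a join, then \<open>A\<close> and
  \<open>B\<close> both cross the new edge and share its ends; these link the two traces, each
  connected by induction.\<close>

lemma tree_on_conn_Int:
  assumes "tree_on N F" "conn F A" "A \<subseteq> N" "conn F B" "B \<subseteq> N" "A \<inter> B \<noteq> {}"
  shows "conn F (A \<inter> B)"
  using assms
proof (induction arbitrary: A B)
  case (single v)
  then have "A \<inter> B = {v}" by auto
  then show ?case by (simp add: conn_singleton)
next
  case (join N1 F1 N2 F2 a b)
  let ?F = "F1 \<union> F2 \<union> {(a, b), (b, a)}"
  note edges = tree_on_edges[OF join.hyps(1)] tree_on_edges[OF join.hyps(2)]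
  note left = conn_join_left[OF edges join.hyps(3-5)]
    and right = conn_join_right[OF edges join.hyps(3-5)]
  have 1: "conn ?F (A \<inter> B \<inter> N1)" if "A \<inter> B \<inter> N1 \<noteq> {}"
  proof -
    have "conn F1 ((A \<inter> N1) \<inter> (B \<inter> N1))"
      by (rule join.IH(1)) (use that join.prems left in blast)+
    moreover have "(A \<inter> N1) \<inter> (B \<inter> N1) = A \<inter> B \<inter> N1" by blast
    ultimately show ?thesis by (auto intro: conn_mono)
  qed
  have 2: "conn ?F (A \<inter> B \<inter> N2)" if "A \<inter> B \<inter> N2 \<noteq> {}"
  proof -
    have "conn F2 ((A \<inter> N2) \<inter> (B \<inter> N2))"
      by (rule join.IH(2)) (use that join.prems right in blast)+
    moreover have "(A \<inter> N2) \<inter> (B \<inter> N2) = A \<inter> B \<inter> N2" by blast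
    ultimately show ?thesis by (auto intro: conn_mono)
  qed
  have split: "A \<inter> B = (A \<inter> B \<inter> N1) \<union> (A \<inter> B \<inter> N2)" using join.prems by blast
  consider "A \<inter> B \<inter> N1 = {}" | "A \<inter> B \<inter> N2 = {}" | "A \<inter> B \<inter> N1 \<noteq> {}" "A \<inter> B \<inter> N2 \<noteq> {}"
    by blast
  then show ?case
  proof cases
    case 1 then show ?thesis using 2 split join.prems(5) by auto
  next
    case 2 then show ?thesis using 1 split join.prems(5) by auto
  next
    case 3
    then have "a \<in> A \<inter> B \<inter> N1" "b \<in> A \<inter> B \<inter> N2"
      using left[OF join.prems(1,2)] left[OF join.prems(3,4)]
        right[OF join.prems(1,2)] right[OF join.prems(3,4)] join.hyps by blast+
    then have "touch ?F (A \<inter> B \<inter> N1) (A \<inter> B \<inter> N2)" by (auto simp: touch_def)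
    with 1 2 3 have "conn ?F ((A \<inter> B \<inter> N1) \<union> (A \<inter> B \<inter> N2))"
      using tree_on_sym[OF tree_on.join[OF join.hyps]] by (intro conn_Un) auto
    with split show ?thesis by simp
  qed
qed

text \<open>If some member lies in one side, all members meet that side, and their traces there
  still meet pairwise: two members that meet beyond the edge both contain its near end. If every
  member meets both sides, all contain \<open>a\<close>.\<close>

lemma tree_on_helly:
  assumes "tree_on N F" "\<S> \<noteq> {}"
    and "\<And>A. A \<in> \<S> \<Longrightarrow> conn F A \<and> A \<subseteq> N"
    and "\<And>A B. A \<in> \<S> \<Longrightarrow> B \<in> \<S> \<Longrightarrow> A \<inter> B \<noteq> {}"
  shows "\<Inter>\<S> \<noteq> {}"
  using assms
proof (induction arbitrary: \<S>)
  case (single v)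
  have "v \<in> A" if "A \<in> \<S>" for A
    using single.prems(2)[OF that] conn_nonempty by fastforce
  then show ?case by blast
next
  case (join N1 F1 N2 F2 a b)
  note edges = tree_on_edges[OF join.hyps(1)] tree_on_edges[OF join.hyps(2)]
  note left = conn_join_left[OF edges join.hyps(3-5)]
    and right = conn_join_right[OF edges join.hyps(3-5)]
  consider (l) A where "A \<in> \<S>" "A \<inter> N2 = {}" | (r) A where "A \<in> \<S>" "A \<inter> N1 = {}"
    | (both) "\<And>A. A \<in> \<S> \<Longrightarrow> A \<inter> N1 \<noteq> {} \<and> A \<inter> N2 \<noteq> {}" by blast
  then show ?case
  proof cases
    case (l A0)
    have meet: "A \<inter> N1 \<noteq> {}" if "A \<in> \<S>" for A
      using join.prems(2)[OF l(1)] join.prems(3)[OF that l(1)] l(2) by blast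
    have "\<Inter>((\<lambda>A. A \<inter> N1) ` \<S>) \<noteq> {}"
    proof (rule join.IH(1))
      fix A assume "A \<in> (\<lambda>A. A \<inter> N1) ` \<S>"
      then obtain A' where "A' \<in> \<S>" "A = A' \<inter> N1" by blast
      then show "conn F1 A \<and> A \<subseteq> N1"
        using left[of A'] meet[of A'] join.prems(2)[of A'] by simp
    next
      fix A B assume "A \<in> (\<lambda>A. A \<inter> N1) ` \<S>" "B \<in> (\<lambda>A. A \<inter> N1) ` \<S>"
      then obtain A' B' where AB: "A' \<in> \<S>" "B' \<in> \<S>" "A = A' \<inter> N1" "B = B' \<inter> N1" by blast
      show "A \<inter> B \<noteq> {}"
      proof (cases "A' \<inter> B' \<inter> N2 = {}")
        case True
        then show ?thesis
          using AB join.prems(2)[of A'] join.prems(3)[of A' B'] by blast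
      next
        case False
        then have "a \<in> A'" "a \<in> B'"
          using left[of A'] left[of B'] meet[of A'] meet[of B'] AB join.prems(2)[of A'] join.prems(2)[of B']
          by auto
        then show ?thesis using AB join.hyps by blast
      qed
    qed (use join.prems in auto)
    then show ?thesis by blast
  next
    case (r A0)
    have meet: "A \<inter> N2 \<noteq> {}" if "A \<in> \<S>" for A
      using join.prems(2)[OF r(1)] join.prems(3)[OF that r(1)] r(2) by blast
    have "\<Inter>((\<lambda>A. A \<inter> N2) ` \<S>) \<noteq> {}"
    proof (rule join.IH(2))
      fix A assume "A \<in> (\<lambda>A. A \<inter> N2) ` \<S>"
      then obtain A' where "A' \<in> \<S>" "A = A' \<inter> N2" by blast
      then show "conn F2 A \<and> A \<subseteq> N2"
        using right[of A'] meet[of A'] join.prems(2)[of A'] by simp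
    next
      fix A B assume "A \<in> (\<lambda>A. A \<inter> N2) ` \<S>" "B \<in> (\<lambda>A. A \<inter> N2) ` \<S>"
      then obtain A' B' where AB: "A' \<in> \<S>" "B' \<in> \<S>" "A = A' \<inter> N2" "B = B' \<inter> N2" by blast
      show "A \<inter> B \<noteq> {}"
      proof (cases "A' \<inter> B' \<inter> N1 = {}")
        case True
        then show ?thesis
          using AB join.prems(2)[of A'] join.prems(3)[of A' B'] by blast
      next
        case False
        then have "b \<in> A'" "b \<in> B'"
          using right[of A'] right[of B'] meet[of A'] meet[of B'] AB join.prems(2)[of A'] join.prems(2)[of B']
          by auto
        then show ?thesis using AB join.hyps by blast
      qed
    qed (use join.prems in auto)
    then show ?thesis by blast
  next
    case both
    have "a \<in> A" if "A \<in> \<S>" for A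
      using left[of A] both[OF that] join.prems(2)[OF that] by blast
    then show ?thesis by blast
  qed
qed

lemma tree_on_conn_Inter:
  assumes "tree_on N F" "\<S> \<noteq> {}" "\<And>A. A \<in> \<S> \<Longrightarrow> conn F A \<and> A \<subseteq> N" "\<Inter>\<S> \<noteq> {}"
  shows "conn F (\<Inter>\<S>)"
proof -
  have "\<S> \<subseteq> Pow N" using assms(3) by blast
  then have "finite \<S>" using tree_on_finite[OF assms(1)] by (simp add: finite_subset)
  then show ?thesis using assms(2-4)
  proof (induction rule: finite_ne_induct)
    case (insert A \<S>)
    have "conn F (\<Inter>\<S>)" using insert.IH insert.prems by auto
    moreover have "\<Inter>\<S> \<subseteq> N" using insert.hyps insert.prems by blast
    ultimately show ?case
      using tree_on_conn_Int[OF assms(1)] insert.prems by simp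
  qed simp
qed

lemma tree_on_image:
  assumes "tree_on N F" "inj f"
  shows "tree_on (f ` N) (map_prod f f ` F)"
  using assms
proof induction
  case (join N1 F1 N2 F2 a b)
  have "f ` (N1 \<union> N2) = f ` N1 \<union> f ` N2"
    "map_prod f f ` (F1 \<union> F2 \<union> {(a, b), (b, a)}) =
      map_prod f f ` F1 \<union> map_prod f f ` F2 \<union> {(f a, f b), (f b, f a)}" by auto
  moreover have "f ` N1 \<inter> f ` N2 = {}" using join by (auto dest: injD)
  ultimately show ?case using join by (simp only:) (intro tree_on.join, auto)
qed (simp add: tree_on.single)

section \<open>Acyclicity in terms of bridges\<close>

text \<open>Every edge is a bridge. Both orientations are removed, so the 2-cycle of an undirected
  edge does no harm; loops are excluded because the closure is reflexive.\<close>

definition bridged :: "'t rel \<Rightarrow> bool" where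
  "bridged F \<longleftrightarrow> (\<forall>x y. (x, y) \<in> F \<longrightarrow> (y, x) \<notin> (F - {(x, y), (y, x)})\<^sup>*)"

lemma bridged_subset: "bridged F \<Longrightarrow> F' \<subseteq> F \<Longrightarrow> bridged F'"
  unfolding bridged_def by (meson Diff_mono order_refl rtrancl_mono subsetD)

text \<open>Contracting everything outside \<open>N1\<close> to \<open>a\<close> turns a walk in the
  join into a walk in \<open>F1\<close>: steps in \<open>F2\<close> and along \<open>ab\<close>
  become stationary, and pairs in \<open>D\<close> remain avoided.\<close>

lemma rtrancl_join_collapse:
  assumes "F1 \<subseteq> N1 \<times> N1" "F2 \<subseteq> N2 \<times> N2" "N1 \<inter> N2 = {}" "a \<in> N1" "b \<in> N2"
    and "(u, v) \<in> (F1 \<union> F2 \<union> {(a, b), (b, a)} - D)\<^sup>*"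
  shows "(if u \<in> N1 then u else a, if v \<in> N1 then v else a) \<in> (F1 - D)\<^sup>*"
  using assms(6)
proof (induction rule: rtrancl_induct)
  case (step v w)
  consider "(v, w) \<in> F1 - D" | "(v, w) \<in> F2" | "v = a" "w = b" | "v = b" "w = a"
    using step.hyps by auto
  then show ?case
  proof cases
    case 1
    moreover from this have "v \<in> N1" "w \<in> N1" using assms(1) by auto
    ultimately show ?thesis using step.IH by (auto intro: rtrancl_into_rtrancl)
  next
    case 2
    then have "v \<notin> N1" "w \<notin> N1" using assms(2,3) by auto
    then show ?thesis using step.IH by auto
  qed (use step.IH assms(3-5) in \<open>auto split: if_splits\<close>)
qed simp

lemma rtrancl_join_stays:
  assumes "F1 \<subseteq> N1 \<times> N1" "F2 \<subseteq> N2 \<times> N2" "N1 \<inter> N2 = {}" "a \<in> N1" "b \<in> N2"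
    and "(a, v) \<in> (F1 \<union> F2 \<union> {(a, b), (b, a)} - {(a, b), (b, a)})\<^sup>*"
  shows "v \<in> N1"
  using assms(6) by (induction rule: rtrancl_induct) (use assms(1-5) in auto)

text \<open>A detour around an old edge would contract to a detour within its own side, excluded by
  induction; without the new edge there is no way across at all.\<close>

lemma tree_on_bridged: "tree_on N F \<Longrightarrow> bridged F"
proof (induction rule: tree_on.induct)
  case (join N1 F1 N2 F2 a b)
  let ?F = "F1 \<union> F2 \<union> {(a, b), (b, a)}"
  note edges = tree_on_edges[OF join.hyps(1)] tree_on_edges[OF join.hyps(2)]
  have disj: "N2 \<inter> N1 = {}" using join.hyps(3) by blast
  note left = join.hyps(3-5) and right = disj join.hyps(5,4)
  show ?case
    unfolding bridged_def
  proof (intro allI impI notI)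
    fix x y
    assume xy: "(x, y) \<in> ?F" and yx: "(y, x) \<in> (?F - {(x, y), (y, x)})\<^sup>*"
    consider "(x, y) \<in> F1" | "(x, y) \<in> F2" | "x = a" "y = b" | "x = b" "y = a"
      using xy by auto
    then show False
    proof cases
      case 1
      with edges have "x \<in> N1" "y \<in> N1" by auto
      then have "(y, x) \<in> (F1 - {(x, y), (y, x)})\<^sup>*"
        using rtrancl_join_collapse[OF edges left yx] by simp
      with 1 join.IH show False by (auto simp: bridged_def)
    next
      case 2
      with edges have "x \<in> N2" "y \<in> N2" by auto
      then have "(y, x) \<in> (F2 - {(x, y), (y, x)})\<^sup>*"
        using rtrancl_join_collapse[OF edges(2,1) right, of y x "{(x, y), (y, x)}"] yx
        by (simp only: join_commute[of F1]) simp
      with 2 join.IH show False by (auto simp: bridged_def)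
    next
      case 3
      then have "(b, a) \<in> (F2 \<union> F1 \<union> {(b, a), (a, b)} - {(b, a), (a, b)})\<^sup>*"
        using yx by (metis (no_types) insert_commute join_commute)
      then show False
        using rtrancl_join_stays[OF edges(2,1) right] join.hyps by blast
    next
      case 4
      then have "(a, b) \<in> (?F - {(a, b), (b, a)})\<^sup>*"
        using yx by (metis (no_types) insert_commute)
      then show False
        using rtrancl_join_stays[OF edges left] join.hyps by blast
    qed
  qed
qed (simp add: bridged_def)

text \<open>Induction on the number of nodes: deleting an edge \<open>xy\<close> leaves exactly the
  components of \<open>x\<close> and \<open>y\<close>, disjoint because the edge is a bridge, and
  the tree is their join.\<close>

lemma bridged_tree_on:
  assumes "finite N" "F \<subseteq> N \<times> N" "sym F" "conn F N" "bridged F"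
  shows "tree_on N F"
  using assms
proof (induction "card N" arbitrary: N F rule: less_induct)
  case less
  show ?case
  proof (cases "F = {}")
    case True
    obtain v where "v \<in> N" using less.prems(4) by (auto simp: conn_def)
    moreover have "w = v" if "w \<in> N" for w
      using less.prems(4) \<open>v \<in> N\<close> that True by (simp add: conn_def)
    ultimately have "N = {v}" by blast
    with True show ?thesis by (simp add: tree_on.single)
  next
    case False
    then obtain x y where xy: "(x, y) \<in> F" by auto
    then have yx: "(y, x) \<in> F" and xyN: "x \<in> N" "y \<in> N"
      using less.prems(2,3) by (auto dest: symD)
    define D where "D = F - {(x, y), (y, x)}"
    define R where "R z = {w. (z, w) \<in> D\<^sup>*}" for z
    have sym_D: "sym D" using less.prems(3) by (auto simp: D_def sym_def)
    then have symR: "sym (D\<^sup>*)" by (rule sym_rtrancl)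
    have refl: "z \<in> R z" for z by (simp add: R_def)
    have closed: "w \<in> R z" if "v \<in> R z" "(v, w) \<in> D" for v w z
      using that by (auto simp: R_def intro: rtrancl_into_rtrancl)
    have disj: "R x \<inter> R y = {}"
    proof (rule ccontr)
      assume "R x \<inter> R y \<noteq> {}"
      then obtain z where "(x, z) \<in> D\<^sup>*" "(y, z) \<in> D\<^sup>*" by (auto simp: R_def)
      then have "(y, x) \<in> D\<^sup>*" using symR by (meson symD rtrancl_trans)
      then show False using less.prems(5) xy by (auto simp: bridged_def D_def)
    qed
    have sub: "R z \<subseteq> N" if "z \<in> N" for z
    proof
      fix w assume "w \<in> R z"
      then have "(z, w) \<in> D\<^sup>*" by (simp add: R_def)
      then show "w \<in> N"
        by (induction rule: rtrancl_induct) (use that less.prems(2) in \<open>auto simp: D_def\<close>)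
    qed
    have cover: "w \<in> R x \<union> R y" if "w \<in> N" for w
      using less.prems(4) xyN(1) that
    proof (induction rule: conn_induct)
      case (step u v)
      then consider "(u, v) \<in> D" | "v = x" | "v = y" by (auto simp: D_def)
      then show ?case using step.IH closed refl by cases auto
    qed (use refl in auto)
    have N: "N = R x \<union> R y" using cover sub xyN by blast
    have F: "F = Restr D (R x) \<union> Restr D (R y) \<union> {(x, y), (y, x)}"
    proof
      have "(u, v) \<in> Restr D (R x) \<union> Restr D (R y)" if "(u, v) \<in> D" for u v
      proof -
        have "u \<in> R x \<union> R y" using that less.prems(2) cover by (auto simp: D_def)
        then show ?thesis using that closed by auto
      qed
      then show "F \<subseteq> Restr D (R x) \<union> Restr D (R y) \<union> {(x, y), (y, x)}"
        by (auto simp: D_def)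
    qed (use xy yx in \<open>auto simp: D_def\<close>)
    have tree: "tree_on (R z) (Restr D (R z))" if "z \<in> N" "card (R z) < card N" for z
    proof (rule less.hyps[OF that(2)])
      show "finite (R z)" using sub[OF that(1)] less.prems(1) by (rule finite_subset)
      show symr: "sym (Restr D (R z))" using sym_D by (auto simp: sym_def)
      show "bridged (Restr D (R z))"
        using less.prems(5) by (rule bridged_subset) (auto simp: D_def)
      show "conn (Restr D (R z)) (R z)"
      proof (rule connI_center[OF symr refl])
        fix w assume "w \<in> R z"
        then have "(z, w) \<in> D\<^sup>*" by (simp add: R_def)
        then show "(z, w) \<in> (Restr (Restr D (R z)) (R z))\<^sup>*"
        proof (induction rule: rtrancl_induct)
          case (step v w)
          then have "v \<in> R z" "w \<in> R z" by (auto simp: R_def intro: rtrancl_into_rtrancl)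
          with step show ?case by (auto intro: rtrancl_into_rtrancl)
        qed simp
      qed
    qed auto
    have "R x \<subset> N" "R y \<subset> N" using N disj refl[of x] refl[of y] by blast+
    then have "card (R x) < card N" "card (R y) < card N"
      using less.prems(1) by (auto intro: psubset_card_mono)
    then have "tree_on (R x \<union> R y) (Restr D (R x) \<union> Restr D (R y) \<union> {(x, y), (y, x)})"
      using tree xyN disj refl by (intro tree_on.join) auto
    then show ?thesis using N F by simp
  qed
qed

section \<open>Comparison with reachability, cycles and trees of pair graphs\<close>

lemma rtrancl_on_iff: "(x, y) \<in> rtrancl_on A E \<longleftrightarrow> x \<in> A \<and> (x, y) \<in> (Restr E A)\<^sup>*"
proof
  assume "(x, y) \<in> rtrancl_on A E"
  then show "x \<in> A \<and> (x, y) \<in> (Restr E A)\<^sup>*"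
    by (induction rule: rtrancl_on_induct) (auto intro: rtrancl_into_rtrancl)
next
  assume "x \<in> A \<and> (x, y) \<in> (Restr E A)\<^sup>*"
  then have "(x, y) \<in> (Restr E A)\<^sup>*" "x \<in> A" by auto
  then show "(x, y) \<in> rtrancl_on A E"
    by (induction rule: rtrancl_induct) (auto intro: rtrancl_on_into_rtrancl_on)
qed

lemma connected_induce_iff_conn:
  assumes "sym (parcs T)"
  shows "Digraph_Component.connected (with_proj T \<restriction> A) \<longleftrightarrow> conn (parcs T) A"
proof -
  have "parcs (mk_symmetric (with_proj T \<restriction> A)) = Restr (parcs T) A"
    using assms by (auto simp: mk_symmetric_def induce_subgraph_def dest: symD)
  moreover have "pverts (mk_symmetric (with_proj T \<restriction> A)) = A"
    by (simp add: mk_symmetric_def induce_subgraph_def)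
  ultimately show ?thesis
    unfolding Digraph_Component.connected_def strongly_connected_def reachable_def conn_def
    by (auto simp: rtrancl_on_iff Int_assoc)
qed

lemma connected_iff_conn:
  assumes "sym (parcs T)" "parcs T \<subseteq> pverts T \<times> pverts T"
  shows "Digraph_Component.connected (with_proj T) \<longleftrightarrow> conn (parcs T) (pverts T)"
proof -
  have "with_proj T \<restriction> pverts T = with_proj T"
    using assms(2) by (auto simp: induce_subgraph_def with_proj_def)
  with connected_induce_iff_conn[OF assms(1), of "pverts T"] show ?thesis by simp
qed

lemma (in pair_wf_digraph) awalk_imp_rtrancl:
  "awalk u p v \<Longrightarrow> set p \<subseteq> D \<Longrightarrow> (u, v) \<in> D\<^sup>*"
  by (induction p arbitrary: u) (auto simp: awalk_simps intro: converse_rtrancl_into_rtrancl)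

lemma (in pair_wf_digraph) arc_ends_in_awalk_verts:
  "awalk u p v \<Longrightarrow> (x, y) \<in> set p \<Longrightarrow> x \<in> set (pawalk_verts u p) \<and> y \<in> set (pawalk_verts u p)"
proof (induction p arbitrary: u)
  case (Cons e p)
  have "snd e \<in> set (pawalk_verts (snd e) p)" by (cases p) (use Cons.prems in \<open>auto simp: awalk_simps\<close>)
  then show ?case using Cons by (auto simp: awalk_simps)
qed simp

text \<open>The rest of a cycle through an edge is a detour around that edge; conversely a detour,
  shortened to a path, closes up to a cycle.\<close>

lemma (in pair_graph) bridged_iff_no_cycle:
  "bridged (parcs G) \<longleftrightarrow> \<not> (\<exists>p. cycle p \<and> 3 \<le> length p)"
proof (intro iffI notI)
  assume br: "bridged (parcs G)" and "\<exists>p. cycle p \<and> 3 \<le> length p"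
  then obtain u p where p: "awalk u p u" "distinct (tl (pawalk_verts u p))" "3 \<le> length p"
    by (auto simp: cycle_def)
  then obtain e e' q where "p = e # e' # q" "q \<noteq> []"
    by (metis (no_types, opaque_lifting) One_nat_def Suc_le_length_iff list.size(3)
        not_less_eq_eq numeral_3_eq_3 zero_le)
  moreover obtain y where "e = (u, y)" using p(1) calculation by (cases e) (auto simp: awalk_simps)
  moreover obtain z where "e' = (y, z)" using p(1) calculation by (cases e') (auto simp: awalk_simps)
  ultimately have p_eq: "p = (u, y) # (y, z) # q" and q: "q \<noteq> []" by auto
  have uy: "(u, y) \<in> parcs G" and yz: "(y, z) \<in> parcs G" and walk: "awalk z q u"
    using p(1) p_eq by (auto simp: awalk_simps)
  have dist: "distinct (pawalk_verts z q)" "y \<notin> set (pawalk_verts z q)"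
    using p(2) p_eq by auto
  \<comment> \<open>Length at least 3 makes \<open>q\<close> non-empty, so the path from
    \<open>z\<close> to \<open>u\<close> has distinct ends and \<open>(y, z)\<close> is not the
    reversal of \<open>(u, y)\<close>.\<close>
  have "z \<noteq> u"
    using apath_nonempty_ends[of z q u] walk dist(1) q by (auto simp: apath_def)
  moreover have "y \<noteq> u" using uy no_loops' by blast
  moreover have "(y, u) \<notin> set q" "(u, y) \<notin> set q"
    using arc_ends_in_awalk_verts[OF walk] dist(2) by blast+
  ultimately have "set ((y, z) # q) \<subseteq> parcs G - {(u, y), (y, u)}"
    using yz walk by auto
  moreover have "awalk y ((y, z) # q) u" using p(1) p_eq by (auto simp: awalk_simps)
  ultimately have "(y, u) \<in> (parcs G - {(u, y), (y, u)})\<^sup>*"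
    by (rule awalk_imp_rtrancl[rotated])
  with br uy show False by (auto simp: bridged_def)
next
  assume no: "\<not> (\<exists>p. cycle p \<and> 3 \<le> length p)"
  show "bridged (parcs G)"
    unfolding bridged_def
  proof (intro allI impI notI)
    fix x y assume xy: "(x, y) \<in> parcs G" and yx: "(y, x) \<in> (parcs G - {(x, y), (y, x)})\<^sup>*"
    define K where "K = \<lparr> pverts = pverts G, parcs = parcs G - {(x, y), (y, x)} \<rparr>"
    then have K_sel: "pverts K = pverts G" "parcs K = parcs G - {(x, y), (y, x)}" by simp_all
    interpret K: pair_wf_digraph K
      by unfold_locales (auto simp: K_sel wellformed')
    have "(y, x) \<in> rtrancl_on (pverts G) (parcs G - {(x, y), (y, x)})"
      using yx wellformed'[OF xy]
      by (rule_tac rtrancl_consistent_rtrancl_on) (auto dest: wellformed')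
    then have "y \<rightarrow>\<^sup>*\<^bsub>K\<^esub> x" by (simp add: reachable_def K_sel)
    then obtain p where p: "K.apath y p x" using K.reachable_apath by auto
    have "awalk y p x" "distinct (pawalk_verts y p)"
      using p by (auto simp: K.apath_def K.awalk_def awalk_def K_sel)
    then have "cycle ((x, y) # p)"
      unfolding cycle_def using xy by (auto simp: awalk_simps intro!: exI[of _ x])
    \<comment> \<open>The path is not empty, as there are no loops, and not the single arc
      \<open>(y, x)\<close>, which is missing in \<open>K\<close>.\<close>
    moreover have "2 \<le> length p"
    proof (rule ccontr)
      assume "\<not> 2 \<le> length p"
      then consider "p = []" | e where "p = [e]" by (cases p rule: remdups_adj.cases) auto
      then show False
        using p xy by cases (auto simp: K.apath_def K.awalk_simps K_sel dest: no_loops')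
    qed
    ultimately show False using no by fastforce
  qed
qed

lemma undirected_tree_iff: "undirected_tree T \<longleftrightarrow> tree_on (pverts T) (parcs T)"
proof
  assume T: "undirected_tree T"
  then interpret pair_graph T by (simp add: undirected_tree_def)
  have "sym (parcs T)" using sym_arcs by (simp add: symmetric_def)
  moreover have "parcs T \<subseteq> pverts T \<times> pverts T" by (auto dest: wellformed')
  moreover have "bridged (parcs T)" using T bridged_iff_no_cycle by (simp add: undirected_tree_def)
  moreover have "Digraph_Component.connected (with_proj T)" using T by (simp add: undirected_tree_def)
  ultimately show "tree_on (pverts T) (parcs T)"
    by (intro bridged_tree_on) (auto simp: connected_iff_conn)
next
  assume T: "tree_on (pverts T) (parcs T)"
  note basic = tree_on_finite[OF T] tree_on_edges[OF T] tree_on_sym[OF T] tree_on_irrefl[OF T]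
  have "finite (parcs T)"
    using basic(1) by (intro finite_subset[OF basic(2)]) simp
  then interpret pair_graph T
    using basic by unfold_locales (auto simp: symmetric_def irrefl_def)
  have "Digraph_Component.connected (with_proj T)"
    using tree_on_conn[OF T] basic by (simp add: connected_iff_conn)
  then show "undirected_tree T"
    unfolding undirected_tree_def
    using pair_graph tree_on_bridged[OF T] bridged_iff_no_cycle by simp
qed

section \<open>Tree-width duality\<close>

text \<open>In relational form the vertex set, the edges and the tree can be varied separately, as
  gluing and restricting require.\<close>

definition tree_decomp :: "'a set \<Rightarrow> 'a rel \<Rightarrow> 't set \<Rightarrow> 't rel \<Rightarrow> ('t \<Rightarrow> 'a set) \<Rightarrow> bool" where
  "tree_decomp V E N F \<beta> \<longleftrightarrow>
     tree_on N F \<and>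
     (\<forall>t\<in>N. \<beta> t \<subseteq> V) \<and>
     (\<forall>v\<in>V. conn F {t \<in> N. v \<in> \<beta> t}) \<and>
     (\<forall>u v. (u, v) \<in> E \<longrightarrow> (\<exists>t\<in>N. u \<in> \<beta> t \<and> v \<in> \<beta> t))"

lemma tree_decomposition_iff:
  "tree_decomposition G T \<beta> \<longleftrightarrow> tree_decomp (pverts G) (parcs G) (pverts T) (parcs T) \<beta>"
proof (cases "tree_on (pverts T) (parcs T)")
  case True
  then have "Digraph_Component.connected (with_proj T \<restriction> A) \<longleftrightarrow> conn (parcs T) A" for A
    using connected_induce_iff_conn tree_on_sym by blast
  moreover have "S \<noteq> {} \<and> conn (parcs T) S \<longleftrightarrow> conn (parcs T) S" for S
    using conn_nonempty by blast
  ultimately show ?thesis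
    unfolding tree_decomposition_def tree_decomp_def undirected_tree_iff
    by (simp only: Ball_def split_paired_All case_prod_conv insert_subset empty_subsetI simp_thms)
qed (simp add: tree_decomposition_def tree_decomp_def undirected_tree_iff)

text \<open>Consecutive vertices of a walk in \<open>D\<close> share a bag, so their subtrees
  overlap and have a connected union.\<close>

lemma tree_decomp_conn_meet:
  assumes td: "tree_decomp V E N F \<beta>" and D: "conn E D" "D \<subseteq> V"
  shows "conn F {t \<in> N. \<beta> t \<inter> D \<noteq> {}}"
proof -
  let ?S = "\<lambda>v. {t \<in> N. v \<in> \<beta> t}" and ?SD = "{t \<in> N. \<beta> t \<inter> D \<noteq> {}}"
  have S: "conn F (?S v)" if "v \<in> D" for v using td D(2) that by (auto simp: tree_decomp_def)
  have path: "(t, t') \<in> (Restr F ?SD)\<^sup>*" if "v \<in> D" "t \<in> ?S v" "t' \<in> ?S v" for v t t'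
  proof -
    have "(t, t') \<in> (Restr F (?S v))\<^sup>*" using S[OF that(1)] that(2,3) by (simp add: conn_def)
    moreover have "Restr F (?S v) \<subseteq> Restr F ?SD" using that(1) by auto
    ultimately show ?thesis using rtrancl_mono by blast
  qed
  obtain v0 where v0: "v0 \<in> D" using D(1) conn_nonempty by blast
  obtain c where c: "c \<in> ?S v0" using S[OF v0] conn_nonempty by blast
  have reach: "\<forall>t\<in>?S v. (c, t) \<in> (Restr F ?SD)\<^sup>*" if "v \<in> D" for v
    using D(1) v0 that
  proof (induction rule: conn_induct)
    case base
    then show ?case using path[OF v0 c] by blast
  next
    case (step u v)
    obtain t where t: "t \<in> ?S u" "t \<in> ?S v"
      using td step.hyps(3) unfolding tree_decomp_def by blast
    then have "(c, t) \<in> (Restr F ?SD)\<^sup>*" using step.IH by blast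
    then show ?case using path[OF step.hyps(2) t(2)] by (meson rtrancl_trans)
  qed
  show ?thesis
  proof (rule connI_center)
    show "sym F" using td tree_on_sym by (auto simp: tree_decomp_def)
    show "c \<in> ?SD" using c v0 by auto
    show "(c, y) \<in> (Restr F ?SD)\<^sup>*" if "y \<in> ?SD" for y using that reach by auto
  qed
qed

lemma tree_decomp_touch:
  assumes "tree_decomp V E N F \<beta>" "touch E A B" "A \<subseteq> V"
  shows "\<exists>t\<in>N. \<beta> t \<inter> A \<noteq> {} \<and> \<beta> t \<inter> B \<noteq> {}"
proof -
  consider v where "v \<in> A" "v \<in> B" | u v where "u \<in> A" "v \<in> B" "(u, v) \<in> E"
    using assms(2) by (auto simp: touch_def)
  then show ?thesis
  proof cases
    case 1
    then have "conn F {t \<in> N. v \<in> \<beta> t}" using assms by (auto simp: tree_decomp_def)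
    then show ?thesis using 1 conn_nonempty by fastforce
  next
    case 2
    then show ?thesis using assms(1) unfolding tree_decomp_def by blast
  qed
qed

section \<open>Gluing decompositions at a root bag\<close>

text \<open>\<open>X\<close> is the bag at which decompositions are glued, \<open>\<A>\<close> the
  family of admissible bags. The node type is fixed as in \<open>treewidth\<close>.\<close>

definition rooted_decomp :: "'a set \<Rightarrow> 'a rel \<Rightarrow> 'a set \<Rightarrow> 'a set set \<Rightarrow> bool" where
  "rooted_decomp V E X \<A> \<longleftrightarrow> (\<exists>(N :: nat set) F \<beta>.
     tree_decomp V E N F \<beta> \<and> X \<in> \<beta> ` N \<and> \<beta> ` N \<subseteq> \<A>)"

lemma rooted_decomp_single:
  assumes "E \<subseteq> X \<times> X" "X \<in> \<A>"
  shows "rooted_decomp X E X \<A>"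
  unfolding rooted_decomp_def
proof (intro exI conjI)
  show "tree_decomp X E {0} {} (\<lambda>_. X)"
    using assms(1) by (auto simp: tree_decomp_def tree_on.single conn_singleton)
qed (use assms(2) in auto)

text \<open>A new edge links the two root nodes. A vertex on both sides lies in both root bags, so
  its two subtrees touch along this edge. \<open>X\<close> stays a bag, so further pieces can be
  attached there.\<close>

lemma rooted_decomp_join:
  assumes "rooted_decomp V1 E1 X \<A>" "rooted_decomp V2 E2 Y \<A>" "V1 \<inter> V2 \<subseteq> X \<inter> Y"
  shows "rooted_decomp (V1 \<union> V2) (E1 \<union> E2) X \<A>"
proof -
  obtain N1 :: "nat set" and F1 \<beta>1 s1 where
    1: "tree_decomp V1 E1 N1 F1 \<beta>1" "s1 \<in> N1" "\<beta>1 s1 = X" "\<beta>1 ` N1 \<subseteq> \<A>"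
    using assms(1) by (auto simp: rooted_decomp_def)
  obtain N2 :: "nat set" and F2 \<beta>2 s2 where
    2: "tree_decomp V2 E2 N2 F2 \<beta>2" "s2 \<in> N2" "\<beta>2 s2 = Y" "\<beta>2 ` N2 \<subseteq> \<A>"
    using assms(2) by (auto simp: rooted_decomp_def)
  \<comment> \<open>Even and odd labels make the node sets disjoint; the parity of a node tells
    which decomposition its bag comes from.\<close>
  define f g where "f n = 2 * n" and "g n = 2 * n + 1" for n :: nat
  have inj: "inj f" "inj g" by (auto simp: f_def g_def inj_def)
  have fg: "f m \<noteq> g n" for m n by (simp add: f_def g_def) presburger
  define N where "N = f ` N1 \<union> g ` N2"
  define F where "F = map_prod f f ` F1 \<union> map_prod g g ` F2 \<union> {(f s1, g s2), (g s2, f s1)}"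
  define \<beta> where "\<beta> n = (if even n then \<beta>1 (n div 2) else \<beta>2 (n div 2))" for n
  have \<beta>: "\<beta> (f n) = \<beta>1 n" "\<beta> (g n) = \<beta>2 n" for n by (simp_all add: \<beta>_def f_def g_def)
  have tree: "tree_on N F"
    unfolding N_def F_def
    using 1 2 fg inj by (intro tree_on.join tree_on_image) (auto simp: tree_decomp_def)
  have nodes: "{t \<in> N. v \<in> \<beta> t} = f ` {t \<in> N1. v \<in> \<beta>1 t} \<union> g ` {t \<in> N2. v \<in> \<beta>2 t}" for v
    by (auto simp: N_def \<beta>)
  have conn1: "conn F (f ` {t \<in> N1. v \<in> \<beta>1 t})" if "v \<in> V1" for v
    by (rule conn_image[of F1]) (use 1(1) that in \<open>auto simp: tree_decomp_def F_def\<close>)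
  have conn2: "conn F (g ` {t \<in> N2. v \<in> \<beta>2 t})" if "v \<in> V2" for v
    by (rule conn_image[of F2]) (use 2(1) that in \<open>auto simp: tree_decomp_def F_def\<close>)
  have none: "v \<notin> V1 \<Longrightarrow> {t \<in> N1. v \<in> \<beta>1 t} = {}" "v \<notin> V2 \<Longrightarrow> {t \<in> N2. v \<in> \<beta>2 t} = {}" for v
    using 1(1) 2(1) by (auto simp: tree_decomp_def)
  have "conn F {t \<in> N. v \<in> \<beta> t}" if "v \<in> V1 \<union> V2" for v
  proof -
    consider "v \<in> V1" "v \<in> V2" | "v \<in> V1" "v \<notin> V2" | "v \<notin> V1" "v \<in> V2" using \<open>v \<in> V1 \<union> V2\<close> by blast
    then show ?thesis
    proof cases
      case 1
      then have "v \<in> X" "v \<in> Y" using assms(3) by auto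
      then have "f s1 \<in> f ` {t \<in> N1. v \<in> \<beta>1 t}" "g s2 \<in> g ` {t \<in> N2. v \<in> \<beta>2 t}"
        using \<open>s1 \<in> N1\<close> \<open>s2 \<in> N2\<close> \<open>\<beta>1 s1 = X\<close> \<open>\<beta>2 s2 = Y\<close> by auto
      moreover have "(f s1, g s2) \<in> F" by (simp add: F_def)
      ultimately have "touch F (f ` {t \<in> N1. v \<in> \<beta>1 t}) (g ` {t \<in> N2. v \<in> \<beta>2 t})"
        unfolding touch_def by blast
      then show ?thesis
        unfolding nodes using conn1 conn2 1 tree_on_sym[OF tree] by (intro conn_Un)
    next
      case 2
      with conn1[of v] none(2)[of v] show ?thesis
        unfolding nodes by (simp only: image_empty Un_empty_right not_False_eq_True)
    next
      case 3
      with conn2[of v] none(1)[of v] show ?thesis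
        unfolding nodes by (simp only: image_empty Un_empty_left not_False_eq_True)
    qed
  qed
  moreover have "\<beta> t \<subseteq> V1 \<union> V2" if "t \<in> N" for t
  proof -
    have "\<And>n. n \<in> N1 \<Longrightarrow> \<beta>1 n \<subseteq> V1" "\<And>n. n \<in> N2 \<Longrightarrow> \<beta>2 n \<subseteq> V2"
      using 1(1) 2(1) by (auto simp: tree_decomp_def)
    then show ?thesis using that by (fastforce simp: N_def \<beta>)
  qed
  moreover have "\<exists>t\<in>N. u \<in> \<beta> t \<and> v \<in> \<beta> t" if "(u, v) \<in> E1 \<union> E2" for u v
  proof -
    have "(\<exists>n\<in>N1. u \<in> \<beta>1 n \<and> v \<in> \<beta>1 n) \<or> (\<exists>n\<in>N2. u \<in> \<beta>2 n \<and> v \<in> \<beta>2 n)"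
      using that 1(1) 2(1) by (auto simp: tree_decomp_def)
    then show ?thesis by (auto simp: N_def \<beta> bex_Un)
  qed
  ultimately have "tree_decomp (V1 \<union> V2) (E1 \<union> E2) N F \<beta>"
    using tree by (auto simp: tree_decomp_def)
  moreover have "X \<in> \<beta> ` N" using 1(2,3) by (force simp: N_def \<beta>)
  moreover have "\<beta> ` N \<subseteq> \<A>" using 1(4) 2(4) by (auto simp: N_def \<beta>)
  ultimately show ?thesis unfolding rooted_decomp_def by blast
qed

section \<open>Brambles, covers and the duality theorem\<close>

definition bramble :: "'a set \<Rightarrow> 'a rel \<Rightarrow> 'a set set \<Rightarrow> bool" where
  "bramble V E \<B> \<longleftrightarrow>
     (\<forall>A\<in>\<B>. A \<subseteq> V \<and> conn E A) \<and> (\<forall>A\<in>\<B>. \<forall>B\<in>\<B>. touch E A B)"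

definition covers :: "'a set \<Rightarrow> 'a set set \<Rightarrow> bool" where
  "covers X \<B> \<longleftrightarrow> (\<forall>A\<in>\<B>. A \<inter> X \<noteq> {})"

text \<open>The exchange argument. Here \<open>X\<close> is a minimum cover and edges leave
  \<open>C\<close> only into \<open>X\<close>. Bags are cut down to \<open>X \<union> C\<close>, and
  each \<open>x \<in> X\<close> is added along the tree path from \<open>s\<close> to a node that
  already has it, so that the bag at \<open>s\<close> becomes \<open>X\<close>. No bag grows: more
  additions than deletions at a node would yield a cover smaller than \<open>X\<close>.\<close>

lemma tree_decomp_restrict:
  assumes fin: "finite V" and td: "tree_decomp V E N F \<beta>"
    and br: "bramble V E \<B>" and E: "sym E" "E \<subseteq> V \<times> V"
    and X: "X \<subseteq> V" "covers X \<B>" "\<forall>Z\<subseteq>V. covers Z \<B> \<longrightarrow> card X \<le> card Z"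
    and C: "C \<subseteq> V" "C \<inter> X = {}" "E `` C \<subseteq> C \<union> X"
    and s: "s \<in> N" "\<beta> s \<inter> C = {}" "covers (\<beta> s) \<B>"
  obtains \<gamma> where "tree_decomp (X \<union> C) (Restr E (X \<union> C)) N F \<gamma>" "\<gamma> s = X"
    "\<And>t. t \<in> N \<Longrightarrow> card (\<gamma> t) \<le> card (\<beta> t)"
    "\<And>t. t \<in> N \<Longrightarrow> \<gamma> t \<inter> C = \<beta> t \<inter> C"
    "\<And>t A. t \<in> N \<Longrightarrow> A \<in> \<B> \<Longrightarrow> A \<inter> \<gamma> t \<noteq> {} \<Longrightarrow> A \<inter> \<beta> t \<noteq> {}"
proof -
  have tree: "tree_on N F" and bags: "\<And>t. t \<in> N \<Longrightarrow> \<beta> t \<subseteq> V"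
    and nodes: "\<And>v. v \<in> V \<Longrightarrow> conn F {t \<in> N. v \<in> \<beta> t}"
    using td by (auto simp: tree_decomp_def)
  have br_conn: "conn E A" "A \<subseteq> V" if "A \<in> \<B>" for A using br that by (auto simp: bramble_def)
  define \<tau> where "\<tau> x = (SOME t. t \<in> N \<and> x \<in> \<beta> t)" for x
  have \<tau>: "\<tau> x \<in> N" "x \<in> \<beta> (\<tau> x)" if "x \<in> X" for x
  proof -
    have "\<exists>t. t \<in> N \<and> x \<in> \<beta> t" using nodes[of x] that X(1) conn_nonempty by fastforce
    then show "\<tau> x \<in> N" "x \<in> \<beta> (\<tau> x)" unfolding \<tau>_def by (metis (mono_tags, lifting) someI_ex)+
  qed
  \<comment> \<open>As the smallest subtree containing \<open>s\<close> and \<open>\<tau> x\<close>,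
    this is the path between them.\<close>
  define P where "P x = \<Inter>{A. A \<subseteq> N \<and> conn F A \<and> s \<in> A \<and> \<tau> x \<in> A}" for x
  have P: "s \<in> P x" "\<tau> x \<in> P x" "conn F (P x)" "P x \<subseteq> N" if "x \<in> X" for x
  proof -
    show "s \<in> P x" "\<tau> x \<in> P x" by (auto simp: P_def)
    have N: "N \<in> {A. A \<subseteq> N \<and> conn F A \<and> s \<in> A \<and> \<tau> x \<in> A}"
      using s(1) \<tau>[OF that] tree_on_conn[OF tree] by simp
    then show "P x \<subseteq> N" unfolding P_def by blast
    show "conn F (P x)"
      unfolding P_def
    proof (rule tree_on_conn_Inter[OF tree])
      show "\<Inter>{A. A \<subseteq> N \<and> conn F A \<and> s \<in> A \<and> \<tau> x \<in> A} \<noteq> {}"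
        using \<open>s \<in> P x\<close> unfolding P_def by blast
    qed (use N in auto)
  qed
  \<comment> \<open>The nodes whose bags meet \<open>D\<close> form a subtree containing
    \<open>s\<close> and \<open>\<tau> x\<close>, hence all of \<open>P x\<close>.\<close>
  have meet: "D \<inter> \<beta> t \<noteq> {}"
    if "conn E D" "D \<subseteq> V" "D \<inter> \<beta> s \<noteq> {}" "x \<in> D" "x \<in> X" "t \<in> P x" for D x t
  proof -
    have "conn F {t \<in> N. \<beta> t \<inter> D \<noteq> {}}" using td that(1,2) by (rule tree_decomp_conn_meet)
    moreover have "s \<in> {t \<in> N. \<beta> t \<inter> D \<noteq> {}}" "\<tau> x \<in> {t \<in> N. \<beta> t \<inter> D \<noteq> {}}"
      using that s(1) \<tau>[of x] by auto
    ultimately have "P x \<subseteq> {t \<in> N. \<beta> t \<inter> D \<noteq> {}}" unfolding P_def by (intro Inter_lower) simp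
    with that(6) show ?thesis by blast
  qed
  define \<gamma> where "\<gamma> t = (\<beta> t \<inter> (X \<union> C)) \<union> {x \<in> X. t \<in> P x}" for t
  show thesis
  proof
    show "tree_decomp (X \<union> C) (Restr E (X \<union> C)) N F \<gamma>"
      unfolding tree_decomp_def
    proof (intro conjI ballI allI impI)
      fix v assume v: "v \<in> X \<union> C"
      then have v_nodes: "conn F {t \<in> N. v \<in> \<beta> t}" using nodes[of v] X(1) C(1) by blast
      show "conn F {t \<in> N. v \<in> \<gamma> t}"
      proof (cases "v \<in> X")
        case True
        then have "{t \<in> N. v \<in> \<gamma> t} = {t \<in> N. v \<in> \<beta> t} \<union> P v"
          using P(4)[OF True] by (auto simp: \<gamma>_def)
        moreover have "touch F {t \<in> N. v \<in> \<beta> t} (P v)"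
          using \<tau>[OF True] P(2)[OF True] by (auto simp: touch_def)
        ultimately show ?thesis
          using v_nodes P(3)[OF True] tree_on_sym[OF tree] by (simp add: conn_Un)
      next
        case False
        then have "{t \<in> N. v \<in> \<gamma> t} = {t \<in> N. v \<in> \<beta> t}" using v by (auto simp: \<gamma>_def)
        with v_nodes show ?thesis by simp
      qed
    next
      fix u v assume "(u, v) \<in> Restr E (X \<union> C)"
      then show "\<exists>t\<in>N. u \<in> \<gamma> t \<and> v \<in> \<gamma> t"
        using td by (fastforce simp: tree_decomp_def \<gamma>_def)
    qed (use tree in \<open>auto simp: \<gamma>_def\<close>)
    show "\<gamma> s = X" using s(2) P(1) by (auto simp: \<gamma>_def)
    show "\<gamma> t \<inter> C = \<beta> t \<inter> C" for t using C(2) by (auto simp: \<gamma>_def)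
    show "A \<inter> \<beta> t \<noteq> {}" if A: "A \<in> \<B>" "A \<inter> \<gamma> t \<noteq> {}" for t A
    proof -
      consider "A \<inter> \<beta> t \<noteq> {}" | x where "x \<in> A" "x \<in> X" "t \<in> P x"
        using A(2) unfolding \<gamma>_def by blast
      then show ?thesis
      proof cases
        case 2
        then show ?thesis
          using meet[OF br_conn[OF A(1)]] s(3) A(1) by (auto simp: covers_def)
      qed
    qed
    show "card (\<gamma> t) \<le> card (\<beta> t)" if t: "t \<in> N" for t
    proof -
      \<comment> \<open>\<open>Q\<close> consists of the vertices added at \<open>t\<close>.
        Exchanging them in \<open>X\<close> for the vertices dropped from \<open>\<beta> t\<close>
        gives \<open>Z\<close>, again a cover, so by minimality of \<open>X\<close> at most as many
        were added as dropped.\<close>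
      define Q where "Q = {x \<in> X. t \<in> P x} - \<beta> t"
      define Z where "Z = (X - Q) \<union> (\<beta> t - (X \<union> C))"
      have finX: "finite X" and fin\<beta>: "finite (\<beta> t)"
        using X(1) bags[OF t] fin by (auto intro: finite_subset)
      have "covers Z \<B>"
        unfolding covers_def
      proof (intro ballI notI)
        fix A assume A: "A \<in> \<B>" and "A \<inter> Z = {}"
        then have AQ: "A \<inter> X \<subseteq> Q" and A\<beta>: "A \<inter> \<beta> t \<subseteq> X \<union> C" by (auto simp: Z_def)
        obtain x y where x: "x \<in> A" "x \<in> X" and y: "y \<in> A" "y \<in> \<beta> s"
          using A X(2) s(3) unfolding covers_def by blast
        have yC: "y \<notin> C" using y s(2) by blast
        \<comment> \<open>Following a walk in \<open>A\<close> from \<open>y\<close> to \<open>x\<close>, it reaches \<open>X\<close> before it enters \<open>C\<close>.\<close>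
        define R where "R = {z. (y, z) \<in> (Restr E (A - C))\<^sup>*}"
        have R: "R \<subseteq> A - C"
        proof
          fix z assume "z \<in> R"
          then have "(y, z) \<in> (Restr E (A - C))\<^sup>*" by (simp add: R_def)
          then show "z \<in> A - C"
            by (induction rule: rtrancl_induct) (use y yC in auto)
        qed
        have "conn E R"
        proof (rule connI_center[OF E(1)])
          show "y \<in> R" by (simp add: R_def)
          fix z assume "z \<in> R"
          then have "(y, z) \<in> (Restr E (A - C))\<^sup>*" by (simp add: R_def)
          then show "(y, z) \<in> (Restr E R)\<^sup>*"
          proof (induction rule: rtrancl_induct)
            case (step u v)
            then have "u \<in> R" "v \<in> R" by (auto simp: R_def intro: rtrancl_into_rtrancl)
            with step show ?case by (auto intro: rtrancl_into_rtrancl)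
          qed simp
        qed
        have "x \<in> R \<or> R \<inter> X \<noteq> {}"
          using br_conn(1)[OF A] y(1) x(1)
        proof (induction rule: conn_induct)
          case base
          then show ?case by (simp add: R_def)
        next
          case (step u v)
          show ?case
          proof (cases "R \<inter> X = {}")
            case True
            then have "u \<in> R" using step.IH by blast
            then have uC: "u \<in> A - C" and "u \<notin> X" using R True by auto
            \<comment> \<open>By symmetry, a vertex outside \<open>C \<union> X\<close> has no
              neighbour in \<open>C\<close>.\<close>
            have "v \<notin> C" using C(3) step.hyps(3) E(1) uC \<open>u \<notin> X\<close> by (auto dest: symD)
            then have "(u, v) \<in> Restr E (A - C)" using uC step.hyps by auto
            then show ?thesis using \<open>u \<in> R\<close> by (auto simp: R_def intro: rtrancl_into_rtrancl)
          qed simp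
        qed
        then obtain x' where x': "x' \<in> R" "x' \<in> X" using x by blast
        then have "x' \<in> Q" using R AQ by blast
        then have "t \<in> P x'" by (simp add: Q_def)
        \<comment> \<open>\<open>R\<close> is connected and contains both \<open>x'\<close> and the
          vertex \<open>y\<close> of the bag at \<open>s\<close>, while \<open>t\<close> lies on
          \<open>P x'\<close>. A vertex of \<open>R\<close> in \<open>\<beta> t\<close> avoids
          \<open>C\<close>, hence lies in \<open>X\<close> and so in \<open>Q\<close>, which
          excludes \<open>\<beta> t\<close>.\<close>
        then have "R \<inter> \<beta> t \<noteq> {}"
          using meet[of R x' t] \<open>conn E R\<close> R br_conn(2)[OF A] x' y by (auto simp: R_def)
        then obtain z where "z \<in> A" "z \<notin> C" "z \<in> \<beta> t" using R by blast
        then have "z \<in> Q" using A\<beta> AQ by blast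
        with \<open>z \<in> \<beta> t\<close> show False by (simp add: Q_def)
      qed
      moreover have "Z \<subseteq> V" using X(1) bags[OF t] by (auto simp: Z_def)
      ultimately have "card X \<le> card Z" using X(3) by blast
      also have "\<dots> \<le> card (X - Q) + card (\<beta> t - (X \<union> C))" unfolding Z_def by (rule card_Un_le)
      finally have "card X \<le> card (X - Q) + card (\<beta> t - (X \<union> C))" .
      moreover have "Q \<subseteq> X" by (auto simp: Q_def)
      then have "card (X - Q) = card X - card Q" "card Q \<le> card X"
        using finX by (auto simp: card_Diff_subset finite_subset intro: card_mono)
      ultimately have Q: "card Q \<le> card (\<beta> t - (X \<union> C))" by linarith
      have "card (\<gamma> t) \<le> card (\<beta> t \<inter> (X \<union> C)) + card Q"
      proof -
        have "\<gamma> t = (\<beta> t \<inter> (X \<union> C)) \<union> Q" by (auto simp: \<gamma>_def Q_def)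
        then show ?thesis by (simp add: card_Un_le)
      qed
      also have "\<dots> \<le> card (\<beta> t \<inter> (X \<union> C)) + card (\<beta> t - (X \<union> C))" using Q by simp
      also have "\<dots> = card (\<beta> t)" by (metis card_Int_Diff fin\<beta>)
      finally show ?thesis .
    qed
  qed
qed

text \<open>Induction on brambles, larger ones first. For a minimum cover \<open>X\<close>, each
  component \<open>C\<close> of \<open>V - X\<close> gets a decomposition of
  \<open>X \<union> C\<close> rooted at \<open>X\<close>, and these are glued. If
  \<open>insert C \<B>\<close> is a bramble, its decomposition is cut down by the exchange argument;
  otherwise some member does not touch \<open>C\<close>, and \<open>C\<close> with its neighbours in
  \<open>X\<close> can serve as a bag.\<close>

theorem bramble_duality:
  assumes fin: "finite V" and E: "sym E" "E \<subseteq> V \<times> V"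
    and order: "\<And>\<B>. bramble V E \<B> \<Longrightarrow> \<exists>X\<subseteq>V. covers X \<B> \<and> card X \<le> k"
    and "bramble V E \<B>"
  shows "\<exists>X. rooted_decomp V E X {Y. card Y > k \<longrightarrow> \<not> covers Y \<B>}"
  using assms(5)
proof (induction "card (Pow V) - card \<B>" arbitrary: \<B> rule: less_induct)
  case less
  let ?\<A> = "{Y. card Y > k \<longrightarrow> \<not> covers Y \<B>}"
  have finPow: "finite (Pow V)" using fin by simp
  have \<B>_Pow: "\<B> \<subseteq> Pow V" using less.prems by (auto simp: bramble_def)
  obtain X where X: "X \<subseteq> V" "covers X \<B>"
    and min: "\<forall>Z\<subseteq>V. covers Z \<B> \<longrightarrow> card X \<le> card Z"
    using order[OF less.prems] ex_has_least_nat[of "\<lambda>X. X \<subseteq> V \<and> covers X \<B>" _ card] by metis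
  have finX: "finite X" using X(1) fin by (rule finite_subset)
  have cardX: "card X \<le> k" using order[OF less.prems] min by (meson order_trans)
  \<comment> \<open>For \<open>x\<close> outside \<open>X\<close>, the component of \<open>x\<close>
    in the graph without \<open>X\<close>.\<close>
  define K where "K x = {y. (x, y) \<in> (Restr E (V - X))\<^sup>*}" for x
  have sym_K: "sym ((Restr E (V - X))\<^sup>*)"
    using E(1) by (intro sym_rtrancl) (auto simp: sym_def)
  have K_refl: "x \<in> K x" for x by (simp add: K_def)
  have K_sub: "K x \<subseteq> V - X" if "x \<in> V - X" for x
  proof
    fix y assume "y \<in> K x"
    then have "(x, y) \<in> (Restr E (V - X))\<^sup>*" by (simp add: K_def)
    then show "y \<in> V - X" by (induction rule: rtrancl_induct) (use that in auto)
  qed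
  have K_conn: "conn E (K x)" for x
  proof (rule connI_center[OF E(1) K_refl])
    fix z assume "z \<in> K x"
    then have "(x, z) \<in> (Restr E (V - X))\<^sup>*" by (simp add: K_def)
    then show "(x, z) \<in> (Restr E (K x))\<^sup>*"
    proof (induction rule: rtrancl_induct)
      case (step u v)
      then have "u \<in> K x" "v \<in> K x" by (auto simp: K_def intro: rtrancl_into_rtrancl)
      with step show ?case by (auto intro: rtrancl_into_rtrancl)
    qed simp
  qed
  have K_closed: "v \<in> K x \<union> X" if "x \<in> V - X" "(u, v) \<in> E" "u \<in> K x" for x u v
  proof (cases "v \<in> X")
    case False
    then have "(u, v) \<in> Restr E (V - X)" using that K_sub E(2) by auto
    then show ?thesis using that(3) by (auto simp: K_def intro: rtrancl_into_rtrancl)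
  qed simp
  have K_disj: "K x = K y" if meet: "K x \<inter> K y \<noteq> {}" for x y
  proof -
    obtain z where "z \<in> K x" "z \<in> K y" using meet by blast
    then have xz: "(x, z) \<in> (Restr E (V - X))\<^sup>*" and yz: "(y, z) \<in> (Restr E (V - X))\<^sup>*"
      by (simp_all only: K_def mem_Collect_eq)
    note xy = rtrancl_trans[OF xz symD[OF sym_K yz]]
    show ?thesis
      unfolding K_def using rtrancl_trans[OF xy] rtrancl_trans[OF symD[OF sym_K xy]] by blast
  qed
  show ?case
  proof (cases "\<exists>X. rooted_decomp V E X ?\<A>")
    case False
    have comp: "rooted_decomp (X \<union> C) (Restr E (X \<union> C)) X ?\<A>" if C_comp: "C \<in> K ` (V - X)" for C
    proof -
      obtain x where x: "x \<in> V - X" "C = K x" using C_comp by blast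
      have C: "C \<subseteq> V" "C \<inter> X = {}" using K_sub x by auto
      have closed: "E `` C \<subseteq> C \<union> X" using K_closed x by blast
      show ?thesis
      proof (cases "bramble V E (insert C \<B>)")
        case True
        \<comment> \<open>\<open>X\<close> covers \<open>\<B>\<close> but misses \<open>C\<close>,
          so \<open>C\<close> is new and the measure drops.\<close>
        have "C \<notin> \<B>" using X(2) C(2) by (auto simp: covers_def)
        moreover have "insert C \<B> \<subseteq> Pow V" using \<B>_Pow C(1) by simp
        then have "card (insert C \<B>) \<le> card (Pow V)" using finPow by (rule card_mono[rotated])
        moreover have "finite \<B>" using \<B>_Pow finPow by (rule finite_subset)
        ultimately have "card (Pow V) - card (insert C \<B>) < card (Pow V) - card \<B>" by simp
        from less.hyps[OF this True] obtain N :: "nat set" and F \<beta> where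
          td: "tree_decomp V E N F \<beta>" and
          adm: "\<And>t. t \<in> N \<Longrightarrow> card (\<beta> t) > k \<Longrightarrow> \<not> covers (\<beta> t) (insert C \<B>)"
          unfolding rooted_decomp_def by fastforce
        \<comment> \<open>Otherwise this decomposition would serve \<open>\<B>\<close> itself,
          against the case assumption. The offending bag covers \<open>\<B>\<close> but not
          \<open>insert C \<B>\<close>, so it misses \<open>C\<close>, as the exchange argument
          requires.\<close>
        have "\<exists>s\<in>N. \<beta> s \<notin> ?\<A>"
        proof (rule ccontr)
          assume "\<not> (\<exists>s\<in>N. \<beta> s \<notin> ?\<A>)"
          then have "\<beta> ` N \<subseteq> ?\<A>" by blast
          moreover have "N \<noteq> {}" using td tree_on_nonempty by (auto simp: tree_decomp_def)
          ultimately show False using False td unfolding rooted_decomp_def by blast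
        qed
        then obtain s where s: "s \<in> N" "card (\<beta> s) > k" "covers (\<beta> s) \<B>" by auto
        then have sC: "\<beta> s \<inter> C = {}" using adm by (auto simp: covers_def)
        obtain \<gamma> where \<gamma>: "tree_decomp (X \<union> C) (Restr E (X \<union> C)) N F \<gamma>" "\<gamma> s = X"
          "\<And>t. t \<in> N \<Longrightarrow> card (\<gamma> t) \<le> card (\<beta> t)"
          "\<And>t. t \<in> N \<Longrightarrow> \<gamma> t \<inter> C = \<beta> t \<inter> C"
          "\<And>t A. t \<in> N \<Longrightarrow> A \<in> \<B> \<Longrightarrow> A \<inter> \<gamma> t \<noteq> {} \<Longrightarrow> A \<inter> \<beta> t \<noteq> {}"
          using tree_decomp_restrict[OF fin td less.prems E X min C closed s(1) sC s(3)] by blast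
        \<comment> \<open>A bag with more than \<open>k\<close> vertices does not fit into
          \<open>X\<close>, so it meets \<open>C\<close>, and so does \<open>\<beta> t\<close>. As
          \<open>\<beta> t\<close> is at least as large, it must miss a member of
          \<open>\<B>\<close>, and \<open>\<gamma> t\<close> misses the same member.\<close>
        have "\<gamma> t \<in> ?\<A>" if t: "t \<in> N" for t
        proof (rule CollectI, rule impI)
          assume big: "k < card (\<gamma> t)"
          have "\<beta> t \<inter> C \<noteq> {}"
          proof
            assume "\<beta> t \<inter> C = {}"
            then have "\<gamma> t \<subseteq> X" using \<gamma>(1) \<gamma>(4)[OF t] t by (auto simp: tree_decomp_def)
            then have "card (\<gamma> t) \<le> card X" using finX by (rule card_mono[rotated])
            then show False using big cardX by simp
          qed
          moreover have "\<not> covers (\<beta> t) (insert C \<B>)" using adm[OF t] big \<gamma>(3)[OF t] by simp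
          ultimately show "\<not> covers (\<gamma> t) \<B>" using \<gamma>(5)[OF t] by (auto simp: covers_def)
        qed
        then show ?thesis
          unfolding rooted_decomp_def using \<gamma>(1,2) s(1) by blast
      next
        case False
        have "touch E C C" using K_refl x by (auto simp: touch_def)
        moreover have "conn E C" using K_conn x by simp
        ultimately obtain A where A: "A \<in> \<B>" "\<not> touch E C A"
          using False less.prems C(1) touch_sym[OF E(1)] unfolding bramble_def by blast
        \<comment> \<open>All edges at \<open>C\<close> lie within \<open>Y\<close>, so two adjacent
          nodes with bags \<open>X\<close> and \<open>Y\<close> decompose
          \<open>X \<union> C\<close>.\<close>
        define Y where "Y = C \<union> {v \<in> X. \<exists>c\<in>C. (c, v) \<in> E}"
        have "A \<inter> Y = {}" using A(2) by (auto simp: touch_def Y_def)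
        then have "Y \<in> ?\<A>" using A(1) by (auto simp: covers_def)
        moreover have "X \<in> ?\<A>" using cardX by simp
        ultimately have "rooted_decomp (X \<union> Y) (Restr E X \<union> Restr E Y) X ?\<A>"
          by (intro rooted_decomp_join[where Y = Y] rooted_decomp_single) auto
        moreover have "X \<union> Y = X \<union> C" by (auto simp: Y_def)
        moreover have "Restr E X \<union> Restr E Y = Restr E (X \<union> C)"
          using closed E(1) by (auto simp: Y_def dest: symD)
        ultimately show ?thesis by simp
      qed
    qed
    \<comment> \<open>Distinct components are disjoint, so each new piece overlaps the union so far
      only within \<open>X\<close>. The term \<open>Restr E X\<close> accounts for the edges inside
      \<open>X\<close> even if there is no component.\<close>
    have glue: "rooted_decomp (X \<union> \<Union>\<C>) (Restr E X \<union> (\<Union>C\<in>\<C>. Restr E (X \<union> C))) X ?\<A>"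
      if "finite \<C>" "\<C> \<subseteq> K ` (V - X)" for \<C>
      using that
    proof (induction rule: finite_induct)
      case empty
      have "X \<in> ?\<A>" using cardX by simp
      then show ?case by (simp add: rooted_decomp_single)
    next
      case (insert C \<C>)
      have "C \<inter> D = {}" if D: "D \<in> \<C>" for D
      proof -
        have "C \<in> K ` (V - X)" "D \<in> K ` (V - X)" using insert.prems D by auto
        then obtain x y where "C = K x" "D = K y" by (elim imageE)
        moreover have "C \<noteq> D" using insert.hyps(2) D by blast
        ultimately show ?thesis using K_disj[of x y] by blast
      qed
      then have disj: "(X \<union> \<Union>\<C>) \<inter> (X \<union> C) \<subseteq> X \<inter> X" by fastforce
      have new: "rooted_decomp (X \<union> C) (Restr E (X \<union> C)) X ?\<A>"
        using insert.prems by (intro comp) simp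
      have old: "rooted_decomp (X \<union> \<Union>\<C>)
          (Restr E X \<union> (\<Union>C\<in>\<C>. Restr E (X \<union> C))) X ?\<A>"
        using insert.prems by (intro insert.IH) simp
      have "rooted_decomp ((X \<union> \<Union>\<C>) \<union> (X \<union> C))
          ((Restr E X \<union> (\<Union>C\<in>\<C>. Restr E (X \<union> C))) \<union> Restr E (X \<union> C)) X ?\<A>"
        using old new disj by (rule rooted_decomp_join)
      moreover have "(X \<union> \<Union>\<C>) \<union> (X \<union> C) = X \<union> \<Union>(insert C \<C>)" by blast
      moreover have "(Restr E X \<union> (\<Union>C\<in>\<C>. Restr E (X \<union> C))) \<union> Restr E (X \<union> C) =
          Restr E X \<union> (\<Union>C\<in>insert C \<C>. Restr E (X \<union> C))" by blast
      ultimately show ?case by simp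
    qed
    have "rooted_decomp (X \<union> \<Union>(K ` (V - X)))
        (Restr E X \<union> (\<Union>C\<in>K ` (V - X). Restr E (X \<union> C))) X ?\<A>"
      using fin by (intro glue) auto
    moreover have "X \<union> \<Union>(K ` (V - X)) = V" using X(1) K_sub K_refl by blast
    \<comment> \<open>An edge with an end outside \<open>X\<close> stays in the component of that
      end or leads into \<open>X\<close>.\<close>
    moreover have "Restr E X \<union> (\<Union>C\<in>K ` (V - X). Restr E (X \<union> C)) = E"
    proof
      show "E \<subseteq> Restr E X \<union> (\<Union>C\<in>K ` (V - X). Restr E (X \<union> C))"
      proof (rule subrelI)
        fix u v assume uv: "(u, v) \<in> E"
        then have V: "u \<in> V" "v \<in> V" and vu: "(v, u) \<in> E" using E by (auto dest: symD)
        consider "u \<in> X" "v \<in> X" | "u \<in> V - X" | "v \<in> V - X" using V by blast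
        then show "(u, v) \<in> Restr E X \<union> (\<Union>C\<in>K ` (V - X). Restr E (X \<union> C))"
        proof cases
          case 2
          then show ?thesis using K_closed[OF 2 uv K_refl] K_refl uv by blast
        next
          case 3
          then show ?thesis using K_closed[OF 3 vu K_refl] K_refl uv by blast
        qed (use uv in auto)
      qed
    qed auto
    ultimately show ?thesis by auto
  qed simp
qed

section \<open>Strong products\<close>

lemma treewidth_ge:
  assumes "pair_graph G"
  shows "treewidth G \<ge> -1"
  using treewidth_attained[OF assms] decomposition_width_ge by metis

text \<open>If every bramble had a cover of at most \<open>k = treewidth H\<close> vertices, duality
  for the empty bramble would give a decomposition with all bags of size at most \<open>k\<close>,
  hence of width below \<open>k\<close>. For negative treewidth the bound is 0 and the empty bramble
  suffices.\<close>

lemma ex_bramble_treewidth: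
  assumes "pair_graph H"
  shows "\<exists>\<B>. bramble (pverts H) (parcs H) \<B> \<and>
    (\<forall>X\<subseteq>pverts H. covers X \<B> \<longrightarrow> treewidth H + 1 \<le> int (card X))"
proof (cases "treewidth H \<ge> 0")
  case False
  have "bramble (pverts H) (parcs H) {}" by (simp add: bramble_def)
  with False show ?thesis by force
next
  case True
  interpret pair_graph H by fact
  define k where "k = nat (treewidth H)"
  show ?thesis
  proof (rule ccontr)
    assume no: "\<not> ?thesis"
    have small: "\<exists>X\<subseteq>pverts H. covers X \<B> \<and> card X \<le> k"
      if "bramble (pverts H) (parcs H) \<B>" for \<B>
    proof -
      obtain X where "X \<subseteq> pverts H" "covers X \<B>" "\<not> treewidth H + 1 \<le> int (card X)"
        using no \<open>bramble _ _ \<B>\<close> by blast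
      then show ?thesis by (intro exI[of _ X]) (auto simp: k_def)
    qed
    have "sym (parcs H)" using sym_arcs by (simp add: symmetric_def)
    moreover have "parcs H \<subseteq> pverts H \<times> pverts H" by (auto dest: wellformed')
    moreover have "bramble (pverts H) (parcs H) {}" by (simp add: bramble_def)
    ultimately have "\<exists>X. rooted_decomp (pverts H) (parcs H) X {Y. card Y > k \<longrightarrow> \<not> covers Y {}}"
      by (intro bramble_duality small) auto
    then obtain N :: "nat set" and F \<beta> where
      td: "tree_decomp (pverts H) (parcs H) N F \<beta>" and bags: "\<And>t. t \<in> N \<Longrightarrow> card (\<beta> t) \<le> k"
      unfolding rooted_decomp_def by (fastforce simp: covers_def)
    let ?T = "\<lparr> pverts = N, parcs = F \<rparr>"
    have "tree_decomposition H ?T \<beta>" using td by (simp add: tree_decomposition_iff)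
    then have "treewidth H \<le> decomposition_width ?T \<beta>" using assms by (rule treewidth_le[rotated])
    moreover have "finite N" "N \<noteq> {}"
      using td tree_on_finite tree_on_nonempty by (auto simp: tree_decomp_def)
    then have "Max ((\<lambda>t. card (\<beta> t)) ` N) \<le> k" using bags by simp
    ultimately show False using True by (simp add: decomposition_width_def k_def)
  qed
qed

section \<open>Factoring a decomposition of the product\<close>

lemma strong_product_conn:
  assumes "conn (parcs H) A" "g \<in> pverts G"
  shows "conn (parcs (G \<boxtimes> H)) ({g} \<times> A)"
proof -
  have "conn (parcs (G \<boxtimes> H)) (Pair g ` A)"
    using assms(1) by (rule conn_image) (use assms(2) in \<open>auto simp: strong_product_def\<close>)
  moreover have "Pair g ` A = {g} \<times> A" by auto
  ultimately show ?thesis by simp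
qed

text \<open>If \<open>g\<close> and \<open>g'\<close> are adjacent, an edge between \<open>A\<close>
  and \<open>B\<close> is lifted to a diagonal edge, the kind that distinguishes the strong from the
  Cartesian product.\<close>

lemma strong_product_touch:
  assumes "touch (parcs H) A B" "A \<subseteq> pverts H" "g \<in> pverts G" "g = g' \<or> (g, g') \<in> parcs G"
  shows "touch (parcs (G \<boxtimes> H)) ({g} \<times> A) ({g'} \<times> B)"
proof -
  consider h where "h \<in> A" "h \<in> B" | h h' where "h \<in> A" "h' \<in> B" "(h, h') \<in> parcs H"
    using assms(1) by (auto simp: touch_def)
  then show ?thesis
  proof cases
    case 1
    then have "g = g' \<or> ((g, h), (g', h)) \<in> parcs (G \<boxtimes> H)"
      using assms by (auto simp: strong_product_def)
    with 1 show ?thesis unfolding touch_def by blast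
  next
    case 2
    then have "((g, h), (g', h')) \<in> parcs (G \<boxtimes> H)"
      using assms by (auto simp: strong_product_def)
    with 2 show ?thesis unfolding touch_def by blast
  qed
qed

lemma tree_decomp_strong_product_factor:
  assumes G: "pair_graph G" and H: "pair_graph H"
    and td: "tree_decomp (pverts (G \<boxtimes> H)) (parcs (G \<boxtimes> H)) N F \<beta>"
    and br: "bramble (pverts H) (parcs H) \<B>" "\<B> \<noteq> {}"
    and order: "\<forall>X\<subseteq>pverts H. covers X \<B> \<longrightarrow> n \<le> card X"
  obtains \<gamma> where "tree_decomp (pverts G) (parcs G) N F \<gamma>"
    "\<And>t. t \<in> N \<Longrightarrow> card (\<gamma> t) * n \<le> card (\<beta> t)"
proof -
  interpret G: pair_graph G by fact
  interpret H: pair_graph H by fact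
  have tree: "tree_on N F" using td by (simp add: tree_decomp_def)
  define S where "S g A = {t \<in> N. \<beta> t \<inter> {g} \<times> A \<noteq> {}}" for g A
  have \<B>: "A \<subseteq> pverts H" "conn (parcs H) A" if "A \<in> \<B>" for A
    using br(1) that by (auto simp: bramble_def)
  have S_conn: "conn F (S g A)" if "g \<in> pverts G" "A \<in> \<B>" for g A
    unfolding S_def
  proof (rule tree_decomp_conn_meet[OF td])
    show "conn (parcs (G \<boxtimes> H)) ({g} \<times> A)"
      using \<B>(2)[OF that(2)] that(1) by (rule strong_product_conn)
    show "{g} \<times> A \<subseteq> pverts (G \<boxtimes> H)"
      using \<B>(1)[OF that(2)] that(1) by (auto simp: strong_product_def)
  qed
  have S_meet: "S g A \<inter> S g' B \<noteq> {}"
    if "g \<in> pverts G" "g = g' \<or> (g, g') \<in> parcs G" "A \<in> \<B>" "B \<in> \<B>" for g g' A B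
  proof -
    have "touch (parcs H) A B" using br(1) that(3,4) by (simp add: bramble_def)
    then have "touch (parcs (G \<boxtimes> H)) ({g} \<times> A) ({g'} \<times> B)"
      using \<B>(1)[OF that(3)] that(1,2) by (rule strong_product_touch)
    moreover have "{g} \<times> A \<subseteq> pverts (G \<boxtimes> H)"
      using \<B>(1)[OF that(3)] that(1) by (auto simp: strong_product_def)
    ultimately have "\<exists>t\<in>N. \<beta> t \<inter> {g} \<times> A \<noteq> {} \<and> \<beta> t \<inter> {g'} \<times> B \<noteq> {}"
      by (rule tree_decomp_touch[OF td])
    then show ?thesis unfolding S_def by blast
  qed
  \<comment> \<open>The Helly property is applied to both families at once, so that one node serves
    all of \<open>\<B>\<close> for \<open>g\<close> and for \<open>g'\<close>. The case
    \<open>g = g'\<close> gives each vertex of \<open>G\<close> a node.\<close>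
  have common: "(\<Inter>A\<in>\<B>. S g A) \<inter> (\<Inter>A\<in>\<B>. S g' A) \<noteq> {}"
    if "g \<in> pverts G" "g' \<in> pverts G" "g = g' \<or> (g, g') \<in> parcs G" for g g'
  proof -
    have g'g: "g' = g \<or> (g', g) \<in> parcs G" using that(3) G.arcs_symmetric by blast
    have "\<Inter>(S g ` \<B> \<union> S g' ` \<B>) \<noteq> {}"
    proof (rule tree_on_helly[OF tree])
      show "S g ` \<B> \<union> S g' ` \<B> \<noteq> {}" using br(2) by simp
      show "conn F A \<and> A \<subseteq> N" if "A \<in> S g ` \<B> \<union> S g' ` \<B>" for A
        using that S_conn \<open>g \<in> pverts G\<close> \<open>g' \<in> pverts G\<close> by (auto simp: S_def)
      fix A B assume "A \<in> S g ` \<B> \<union> S g' ` \<B>" "B \<in> S g ` \<B> \<union> S g' ` \<B>"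
      then obtain a b A' B' where ab: "a \<in> {g, g'}" "b \<in> {g, g'}"
        and A'B': "A' \<in> \<B>" "B' \<in> \<B>" "A = S a A'" "B = S b B'" by blast
      have "a \<in> pverts G" "a = b \<or> (a, b) \<in> parcs G" using ab that g'g by auto
      then show "A \<inter> B \<noteq> {}" using S_meet A'B' by simp
    qed
    then show ?thesis by (simp add: Inf_union_distrib)
  qed
  define \<gamma> where "\<gamma> t = {g \<in> pverts G. t \<in> (\<Inter>A\<in>\<B>. S g A)}" for t
  have sub: "(\<Inter>A\<in>\<B>. S g A) \<subseteq> N" for g using br(2) by (auto simp: S_def)
  show thesis
  proof
    show "tree_decomp (pverts G) (parcs G) N F \<gamma>"
      unfolding tree_decomp_def
    proof (intro conjI ballI allI impI)
      fix g assume g: "g \<in> pverts G"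
      have "conn F (\<Inter>(S g ` \<B>))"
        by (rule tree_on_conn_Inter[OF tree])
          (use br(2) S_conn[OF g] common[OF g g] in \<open>auto simp: S_def\<close>)
      moreover have "{t \<in> N. g \<in> \<gamma> t} = (\<Inter>A\<in>\<B>. S g A)" using sub g unfolding \<gamma>_def by blast
      ultimately show "conn F {t \<in> N. g \<in> \<gamma> t}" by simp
    next
      fix g g' assume gg': "(g, g') \<in> parcs G"
      then have V: "g \<in> pverts G" "g' \<in> pverts G" by (auto dest: G.wellformed')
      then obtain t where "t \<in> (\<Inter>A\<in>\<B>. S g A)" "t \<in> (\<Inter>A\<in>\<B>. S g' A)"
        using common[of g g'] gg' by blast
      moreover from this have "t \<in> N" using sub by blast
      ultimately show "\<exists>t\<in>N. g \<in> \<gamma> t \<and> g' \<in> \<gamma> t" using V unfolding \<gamma>_def by blast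
    qed (use tree in \<open>auto simp: \<gamma>_def\<close>)
    show "card (\<gamma> t) * n \<le> card (\<beta> t)" if t: "t \<in> N" for t
    proof -
      have \<beta>_sub: "\<beta> t \<subseteq> pverts G \<times> pverts H"
        using td t by (auto simp: tree_decomp_def strong_product_def)
      then have fin: "finite (\<beta> t)" by (rule finite_subset) simp
      \<comment> \<open>The fibre of \<open>\<beta> t\<close> over \<open>g\<close>. For
        \<open>g \<in> \<gamma> t\<close> it covers \<open>\<B>\<close> and so has at least
        \<open>n\<close> elements; different fibres occupy disjoint parts of
        \<open>\<beta> t\<close>.\<close>
      define X where "X g = {h. (g, h) \<in> \<beta> t}" for g
      have XH: "X g \<subseteq> pverts H" for g using \<beta>_sub by (auto simp: X_def)
      have "n \<le> card (X g)" if "g \<in> \<gamma> t" for g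
      proof -
        have "covers (X g) \<B>" using that by (fastforce simp: covers_def \<gamma>_def S_def X_def)
        with order XH show ?thesis by blast
      qed
      then have "card (\<gamma> t) * n \<le> (\<Sum>g\<in>\<gamma> t. card (X g))"
        using sum_bounded_below[of "\<gamma> t" n "\<lambda>g. card (X g)"] by simp
      also have "\<dots> = card (SIGMA g:\<gamma> t. X g)"
      proof (rule card_SigmaI[symmetric])
        show "finite (\<gamma> t)" by (simp add: \<gamma>_def)
        show "\<forall>g\<in>\<gamma> t. finite (X g)"
          using finite_subset[OF XH H.finite_verts] by blast
      qed
      also have "\<dots> \<le> card (\<beta> t)"
        using fin by (rule card_mono) (auto simp: X_def)
      finally show ?thesis .
    qed
  qed
qed

theorem theorem1:
  fixes G :: "'a pair_pre_digraph" and H :: "'b pair_pre_digraph"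
  assumes "pair_graph G" and "pair_graph H"
  shows "treewidth (G \<boxtimes> H) \<ge> (treewidth G + 1) * (treewidth H + 1) - 1"
proof -
  have GH: "pair_graph (G \<boxtimes> H)" using assms by (rule pair_graph_strong_product)
  obtain T :: "nat pair_pre_digraph" and \<beta> where
    T: "tree_decomposition (G \<boxtimes> H) T \<beta>" "decomposition_width T \<beta> = treewidth (G \<boxtimes> H)"
    using treewidth_attained[OF GH] by blast
  obtain \<B> where br: "bramble (pverts H) (parcs H) \<B>"
    and order: "\<And>X. X \<subseteq> pverts H \<Longrightarrow> covers X \<B> \<Longrightarrow> treewidth H + 1 \<le> int (card X)"
    using ex_bramble_treewidth[OF assms(2)] by blast
  show ?thesis
  proof (cases "\<B> = {}")
    case True
    \<comment> \<open>The empty set covers an empty bramble, so \<open>treewidth H = -1\<close>, the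
      product vanishes and the general lower bound -1 is enough.\<close>
    then have "treewidth H + 1 \<le> 0" using order[of "{}"] by (simp add: covers_def)
    then have "treewidth H + 1 = 0" using treewidth_ge[OF assms(2)] by simp
    then show ?thesis using treewidth_ge[OF GH] by simp
  next
    case False
    have td: "tree_decomp (pverts (G \<boxtimes> H)) (parcs (G \<boxtimes> H)) (pverts T) (parcs T) \<beta>"
      using T(1) by (simp add: tree_decomposition_iff)
    have order_nat: "\<forall>X\<subseteq>pverts H. covers X \<B> \<longrightarrow> nat (treewidth H + 1) \<le> card X"
      using order by (simp add: nat_le_iff)
    obtain \<gamma> where \<gamma>: "tree_decomp (pverts G) (parcs G) (pverts T) (parcs T) \<gamma>"
      "\<And>t. t \<in> pverts T \<Longrightarrow> card (\<gamma> t) * nat (treewidth H + 1) \<le> card (\<beta> t)"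
      using tree_decomp_strong_product_factor[OF assms td br False order_nat] by blast
    have tree: "tree_on (pverts T) (parcs T)" using \<gamma>(1) by (simp add: tree_decomp_def)
    have fin: "finite (pverts T)" and ne: "pverts T \<noteq> {}"
      using tree_on_finite[OF tree] tree_on_nonempty[OF tree] by auto
    \<comment> \<open>A largest bag of \<open>\<gamma>\<close> has at least
      \<open>treewidth G + 1\<close> vertices; the bag of \<open>\<beta>\<close> at the same node
      gives the bound.\<close>
    have "Max ((\<lambda>t. card (\<gamma> t)) ` pverts T) \<in> (\<lambda>t. card (\<gamma> t)) ` pverts T"
      using fin ne by (intro Max_in) auto
    then obtain t where t: "t \<in> pverts T" "card (\<gamma> t) = Max ((\<lambda>t. card (\<gamma> t)) ` pverts T)"
      by auto
    have "treewidth G \<le> decomposition_width T \<gamma>"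
      using assms(1) \<gamma>(1) by (intro treewidth_le) (auto simp: tree_decomposition_iff)
    then have "treewidth G + 1 \<le> int (card (\<gamma> t))" using t(2) by (simp add: decomposition_width_def)
    \<comment> \<open>The conversion by \<open>nat\<close> is exact, since treewidth is at least
      -1.\<close>
    then have "(treewidth G + 1) * (treewidth H + 1) \<le>
        int (card (\<gamma> t)) * int (nat (treewidth H + 1))"
      using treewidth_ge[OF assms(2)] by (simp add: mult_right_mono)
    also have "\<dots> \<le> int (card (\<beta> t))" using \<gamma>(2)[OF t(1)] by (metis of_nat_mono of_nat_mult)
    also have "\<dots> \<le> int (Max ((\<lambda>t. card (\<beta> t)) ` pverts T))" using fin t(1) by simp
    also have "\<dots> = treewidth (G \<boxtimes> H) + 1" using T(2) by (simp add: decomposition_width_def)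
    finally show ?thesis by simp
  qed
qed

end
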